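(* Let $\mathcal M=(Q,H,\phi)$ be a forced Hamiltonian system, let $\mathcal M^E_{d,h}$ be its exact discretization, and let $\mathcal M_{d,h}=(Q,H_{d,h},\phi_{d,h})$ be any discretization of $\mathcal M$ of contact order $r\in\mathbb N$. Then, as maps of $(x,h)$ near $T^*Q\times\{0\}\subset T^*Q\times\mathbb R$ (where $x\in T^*Q$), $$\mathbf F^{\mathcal M}_h=\mathbf F^{\mathcal M^E_{d,h}}=\mathbf F^{\mathcal M_{d,h}}+\mathcal O(h^{r+1}),$$ where $\mathbf F^{\mathcal M}_h$ is the time-$h$ flow of the forced Hamilton equations of $\mathcal M$, and $\mathbf F^{\mathcal M^E_{d,h}}$, $\mathbf F^{\mathcal M_{d,h}}$ are the discrete flows.
   Context: **Continuous systems.** $Q$ is a finite-dimensional real vector space and $T^*Q\simeq Q\times Q^*$. A forced Hamiltonian system is a triple $(Q,H,\phi)$ with $H:T^*Q\to\mathbb R$ smooth and $\phi\in\Omega^1(T^*Q)$ a smooth horizontal 1-form, so that $\phi(q,p)(\delta q,\delta p)=\check\phi(q,p)(\delta q)$ with $\check\phi(q,p)\in Q^*$. Its trajectories are the solutions of the forced Hamilton equations $\dot q=D_2H(q,p)$, $\dot p=-D_1H(q,p)+\check\phi(q,p)$, and $\mathbf F^{\mathcal M}_t$ denotes the (initial value) flow of these equations. **Boundary value flow (standing assumption).** For $(q_0,p_1,h)$ in an open neighborhood of $T^*Q\times\{0\}$ in $T^*Q\times\mathbb R$, there is a unique trajectory $(q(t),p(t))$ of $\mathcal M$, defined for $t$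 between $0$ and $h$, with $q(0)=q_0$ and $p(h)=p_1$, and it depends smoothly on $(t,h,q_0,p_1)$. It is denoted $(q(t),p(t))=\mathbf F^{\mathcal M}_{h,t}(q_0,p_1)$. **FDHS.** A forced discrete Hamiltonian system (FDHS) is a triple $(Q,H_d,\phi_d)$ with $H_d:T^*Q\to\mathbb R$ smooth and $\phi_d$ a smooth 1-form on $T^*Q$. Write $\phi_d(q,p)(\delta q,\delta p)=\phi_d^q(q,p)(\delta q)+\phi_d^p(q,p)(\delta p)$. Its forced discrete Legendre transforms are $$\mathbb F^+_{\phi_d}H_d(q_0,p_1)=(D_2H_d(q_0,p_1)-\phi_d^p(q_0,p_1),\,p_1),\qquad \mathbb F^-_{\phi_d}H_d(q_0,p_1)=(q_0,\,D_1H_d(q_0,p_1)-\phi_d^q(q_0,p_1)).$$ A smooth 1-parameter family $(Q,H_{d,h},\phi_{d,h})$ is one where $H_{d,h}(q,p)$ and $\phi_{d,h}(q,p)$ are smooth in $(q,p,h)$ on an open neighborhood of $T^*Q\times\{0\}$ in $T^*Q\times\mathbb R$. **Discrete flow.** $\mathbf F^{\mathcal M_{d,h}}=(\mathbb F^+_{\phi_{d,h}}H_{d,h})\circ(\mathbb F^-_{\phi_{d,h}}H_{d,h})^{-1}$. When $\mathbb F^-_{\phi_{d,h}}H_{d,h}$ is a diffeomorphism of $T^*Q$ at $h=0$, the map $(x,h)\mapsto(\mathbb F^-_{\phi_{d,h}}H_{d,h}(x),h)$ is a diffeomorphism between open neighborhoods of $T^*Q\times\{0\}$, and the inverse is taken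 there, so that the flow is a smooth map of $(x,h)$ defined on an open neighborhood of $T^*Q\times\{0\}$ with values in $T^*Q$. **Exact discretization.** $\mathcal M^E_{d,h}=(Q,H^E_{d,h},\phi^E_{d,h})$ with, for $h\ne0$ and $(q(t),p(t))=\mathbf F^{\mathcal M}_{h,t}(q_0,p_1)$, $$H^E_{d,h}(q_0,p_1)=p(h)q(h)-\int_0^h\big(p(t)\dot q(t)-H(q(t),p(t))\big)dt,$$ $$\phi^E_{d,h}(q_0,p_1)(\delta q_0,\delta p_1)=\int_0^h\phi(q(t),p(t))\big(T_{(q_0,p_1)}\mathbf F^{\mathcal M}_{h,t}(\delta q_0,\delta p_1)\big)dt,$$ and $H^E_{d,0}(q_0,p_1)=p_1q_0$, $\phi^E_{d,0}=0$. **Contact order.** For smooth maps $f_1,f_2$ defined on open neighborhoods $\mathcal W_1,\mathcal W_2$ of $X\times\{0\}$ in $X\times\mathbb R$ ($X$ a finite-dimensional real vector space) with values in a finite-dimensional real vector space $Y$, $f_2=f_1+\mathcal O(h^{r+1})$ means that there are an open $U\subset\mathcal W_1\cap\mathcal W_2$ containing $X\times\{0\}$ and a continuous $\delta f:U\to Y$ with $f_2(x,h)-f_1(x,h)=h^{r+1}\delta f(x,h)$ on $U$. For families of FDHSs, $\mathcal M^2_{d,h}=\mathcal M^1_{d,h}+\mathcal O(h^{r+1})$ means $H^2_{d,h}=H^1_{d,h}+\mathcal O(h^{r+1})$ and $\phi^2_{d,h}=\phi^1_{d,h}+\mathcal O(h^{r+1})$, where 1-forms are viewed as maps to $(Q\times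 Q^* )^*$. **Discretization.** A smooth 1-parameter family of FDHSs $\mathcal M_{d,h}=(Q,H_{d,h},\phi_{d,h})$ is a discretization of $\mathcal M$ if $H_{d,h}(q_0,p_1)=p_1q_0+hH(q_0,p_1)+\mathcal O(h^2)$ and $\phi_{d,h}(q_0,p_1)=h\,\phi(q_0,p_1)+\mathcal O(h^2)$. It has contact order $r$ if $\mathcal M_{d,h}=\mathcal M^E_{d,h}+\mathcal O(h^{r+1})$. The first equality in the claim means equality on some open neighborhood of $T^*Q\times\{0\}$. *)

theory Defs
  imports "HOL-Analysis.Analysis"
begin

text \<open>
  The configuration space \<open>Q\<close> is a type \<open>'q\<close> of class \<^class>\<open>euclidean_space\<close>. The inner product
  is never used to identify \<open>Q\<close> with \<open>Q\<^sup>*\<close>: momenta are genuine covectors, and \<open>T\<^sup>*Q\<close> is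
  \<open>Q \<times> Q\<^sup>*\<close>.
\<close>

type_synonym 'q phase = "'q \<times> ('q \<Rightarrow>\<^sub>L real)"
type_synonym 'q covector = "('q \<times> ('q \<Rightarrow>\<^sub>L real)) \<Rightarrow>\<^sub>L real"


section \<open>Smooth maps\<close>

text \<open>
  Only used on open sets and for finite-dimensional domains, where differentiability together with
  \<open>C\<^sup>n\<close> directional derivatives in every direction is the same as \<open>C\<^sup>n\<^sup>+\<^sup>1\<close>.
\<close>

primrec Ck_on :: "nat \<Rightarrow> 'a::real_normed_vector set \<Rightarrow> ('a \<Rightarrow> 'b::real_normed_vector) \<Rightarrow> bool" where
  "Ck_on 0 S f \<longleftrightarrow> continuous_on S f"
| "Ck_on (Suc n) S f \<longleftrightarrow> (\<forall>x\<in>S. f differentiable (at x)) \<and>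
     (\<forall>v. Ck_on n S (\<lambda>x. frechet_derivative f (at x) v))"

definition smooth_on :: "'a::real_normed_vector set \<Rightarrow> ('a \<Rightarrow> 'b::real_normed_vector) \<Rightarrow> bool" where
  "smooth_on S f \<longleftrightarrow> (\<forall>n. Ck_on n S f)"

definition diffeo_between ::
  "('a::real_normed_vector \<Rightarrow> 'b::real_normed_vector) \<Rightarrow> 'a set \<Rightarrow> 'b set \<Rightarrow> bool" where
  "diffeo_between f U V \<longleftrightarrow> open U \<and> open V \<and> bij_betw f U V \<and>
     smooth_on U f \<and> smooth_on V (inv_into U f)"

definition nbhd_of_zero_section :: "('x::real_normed_vector \<times> real) set \<Rightarrow> bool" where
  "nbhd_of_zero_section U \<longleftrightarrow> open U \<and> UNIV \<times> {0} \<subseteq> U"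

text \<open>
  \<open>equal_up_to k W1 f1 W2 f2\<close> is \<open>f2 = f1 + O(h\<^sup>k)\<close>, for families \<open>f1\<close>, \<open>f2\<close> (parameter first)
  considered on the domains \<open>W1\<close>, \<open>W2\<close>.
\<close>

definition equal_up_to ::
  "nat \<Rightarrow> ('x::real_normed_vector \<times> real) set \<Rightarrow> (real \<Rightarrow> 'x \<Rightarrow> 'y::real_normed_vector) \<Rightarrow>
   ('x \<times> real) set \<Rightarrow> (real \<Rightarrow> 'x \<Rightarrow> 'y) \<Rightarrow> bool" where
  "equal_up_to k W1 f1 W2 f2 \<longleftrightarrow>
     (\<exists>U \<delta>. nbhd_of_zero_section U \<and> U \<subseteq> W1 \<inter> W2 \<and> continuous_on U \<delta> \<and>
        (\<forall>(x, h)\<in>U. f2 h x - f1 h x = h ^ k *\<^sub>R \<delta> (x, h)))"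


section \<open>Components of covectors and of differentials\<close>

text \<open>
  A covector \<open>\<lambda>\<close> on \<open>Q \<times> Q\<^sup>*\<close> has a component in \<open>Q\<^sup>*\<close> and one in \<open>Q\<^sup>*\<^sup>* \<cong> Q\<close>; the latter is
  represented by the vector \<open>v\<close> with \<open>\<lambda>(0, \<alpha>) = \<alpha>(v)\<close> (see \<open>pcomp_apply\<close> below).
\<close>

definition qcomp :: "'q::euclidean_space covector \<Rightarrow> 'q \<Rightarrow>\<^sub>L real" where
  "qcomp l = Blinfun (\<lambda>v. blinfun_apply l (v, 0))"

definition pcomp :: "'q::euclidean_space covector \<Rightarrow> 'q" where
  "pcomp l = (THE v. \<forall>\<alpha>. blinfun_apply l (0, \<alpha>) = blinfun_apply \<alpha> v)"

definition differential :: "('q::euclidean_space phase \<Rightarrow> real) \<Rightarrow> 'q phase \<Rightarrow> 'q covector" where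
  "differential H x = Blinfun (frechet_derivative H (at x))"

definition D1 :: "('q::euclidean_space phase \<Rightarrow> real) \<Rightarrow> 'q phase \<Rightarrow> 'q \<Rightarrow>\<^sub>L real" where
  "D1 H x = qcomp (differential H x)"

definition D2 :: "('q::euclidean_space phase \<Rightarrow> real) \<Rightarrow> 'q phase \<Rightarrow> 'q" where
  "D2 H x = pcomp (differential H x)"

lemma qcomp_apply: "blinfun_apply (qcomp l) v = blinfun_apply l (v, 0)"
  unfolding qcomp_def
  by (rule bounded_linear_Blinfun_apply[OF bounded_linear_compose[OF blinfun.bounded_linear_right
        bounded_linear_Pair[OF bounded_linear_ident bounded_linear_zero]], THEN fun_cong])

lemma pcomp_apply: "blinfun_apply \<alpha> (pcomp l) = blinfun_apply l (0, \<alpha>)"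
proof -
  let ?v = "\<Sum>b\<in>Basis. blinfun_apply l (0, blinfun_inner_left b) *\<^sub>R b"
  have v: "blinfun_apply l (0, \<alpha>) = blinfun_apply \<alpha> ?v" for \<alpha>
  proof -
    let ?S = "\<Sum>b\<in>Basis. blinfun_apply \<alpha> b *\<^sub>R blinfun_inner_left b"
    have \<alpha>: "\<alpha> = ?S"
    proof (rule blinfun_eqI)
      fix v :: 'a
      have "blinfun_apply \<alpha> v = blinfun_apply \<alpha> (\<Sum>b\<in>Basis. (v \<bullet> b) *\<^sub>R b)"
        by (simp only: euclidean_representation)
      also have "\<dots> = blinfun_apply ?S v"
        by (simp only: blinfun.sum_right blinfun.scaleR_right blinfun.sum_left blinfun.scaleR_left
            blinfun_inner_left.rep_eq inner_commute real_scaleR_def mult.commute)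
      finally show "blinfun_apply \<alpha> v = blinfun_apply ?S v" .
    qed
    have lin: "linear (\<lambda>\<alpha>. blinfun_apply l (0, \<alpha>))"
      by (rule bounded_linear.linear[OF bounded_linear_compose[OF blinfun.bounded_linear_right
            bounded_linear_Pair[OF bounded_linear_zero bounded_linear_ident]]])
    have "blinfun_apply l (0, \<alpha>) = blinfun_apply l (0, ?S)"
      using arg_cong[OF \<alpha>, of "\<lambda>a. blinfun_apply l (0, a)"] .
    also have "\<dots> = (\<Sum>b\<in>Basis. blinfun_apply \<alpha> b *\<^sub>R blinfun_apply l (0, blinfun_inner_left b))"
      by (simp only: linear_sum[OF lin] linear_cmul[OF lin])
    also have "\<dots> = blinfun_apply \<alpha> ?v"
      by (simp only: blinfun.sum_right blinfun.scaleR_right real_scaleR_def mult.commute)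
    finally show ?thesis .
  qed
  have "\<forall>\<alpha>. blinfun_apply l (0, \<alpha>) = blinfun_apply \<alpha> (pcomp l)"
    unfolding pcomp_def
  proof (rule theI)
    show "\<forall>\<alpha>. blinfun_apply l (0, \<alpha>) = blinfun_apply \<alpha> ?v"
      using v by blast
    fix w assume w: "\<forall>\<alpha>. blinfun_apply l (0, \<alpha>) = blinfun_apply \<alpha> w"
    show "w = ?v"
    proof (rule euclidean_eqI)
      fix b :: 'a
      show "w \<bullet> b = ?v \<bullet> b"
        using trans[OF v[of "blinfun_inner_left b", symmetric] w[rule_format, of "blinfun_inner_left b"]]
        by (simp only: blinfun_inner_left.rep_eq inner_commute)
    qed
  qed
  then show ?thesis by simp
qed


section \<open>Forced Hamiltonian systems\<close>

definition horizontal :: "('q::euclidean_space phase \<Rightarrow> 'q covector) \<Rightarrow> bool" where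
  "horizontal \<phi> \<longleftrightarrow> (\<exists>\<psi>. \<forall>x \<delta>q \<delta>p. blinfun_apply (\<phi> x) (\<delta>q, \<delta>p) = blinfun_apply (\<psi> x) \<delta>q)"

definition forced_hamiltonian_system ::
  "('q::euclidean_space phase \<Rightarrow> real) \<Rightarrow> ('q phase \<Rightarrow> 'q covector) \<Rightarrow> bool" where
  "forced_hamiltonian_system H \<phi> \<longleftrightarrow> smooth_on UNIV H \<and> smooth_on UNIV \<phi> \<and> horizontal \<phi>"

text \<open>
  For horizontal \<open>\<phi>\<close>, \<open>qcomp (\<phi> x)\<close> is the force \<open>\<psi> x \<in> Q\<^sup>*\<close> of the definition above. A trajectory
  between \<open>0\<close> and \<open>h\<close> (of either sign) is only constrained on the closed segment.
\<close>

definition trajectory ::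
  "('q::euclidean_space phase \<Rightarrow> real) \<Rightarrow> ('q phase \<Rightarrow> 'q covector) \<Rightarrow> real \<Rightarrow>
   (real \<Rightarrow> 'q phase) \<Rightarrow> bool" where
  "trajectory H \<phi> h z \<longleftrightarrow> (\<forall>t\<in>closed_segment 0 h.
     ((\<lambda>s. fst (z s)) has_vector_derivative D2 H (z t)) (at t within closed_segment 0 h) \<and>
     ((\<lambda>s. snd (z s)) has_vector_derivative - D1 H (z t) + qcomp (\<phi> (z t)))
        (at t within closed_segment 0 h))"

text \<open>
  Initial value flow at time \<open>h\<close>; the end point is unique by Picard--Lindeloef, and exists for
  \<open>(x, h)\<close> in \<open>flow_domain\<close>.
\<close>

definition flow_domain ::
  "('q::euclidean_space phase \<Rightarrow> real) \<Rightarrow> ('q phase \<Rightarrow> 'q covector) \<Rightarrow> ('q phase \<times> real) set" where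
  "flow_domain H \<phi> = {(x, h). \<exists>z. trajectory H \<phi> h z \<and> z 0 = x}"

definition flow ::
  "('q::euclidean_space phase \<Rightarrow> real) \<Rightarrow> ('q phase \<Rightarrow> 'q covector) \<Rightarrow> real \<Rightarrow> 'q phase \<Rightarrow> 'q phase" where
  "flow H \<phi> h x = (THE y. \<exists>z. trajectory H \<phi> h z \<and> z 0 = x \<and> z h = y)"

text \<open>
  \<open>F h t (q0, p1)\<close> is the value at time \<open>t\<close> of the trajectory with \<open>q(0) = q0\<close> and \<open>p(h) = p1\<close>. Its
  natural domain \<open>{(t, h, x). (x, h) \<in> W \<and> t \<in> closed_segment 0 h}\<close> is not open; as usual,
  smoothness there means having a smooth extension \<open>G\<close> to an open set.
\<close>

definition boundary_value_flow ::
  "('q::euclidean_space phase \<Rightarrow> real) \<Rightarrow> ('q phase \<Rightarrow> 'q covector) \<Rightarrow> ('q phase \<times> real) set \<Rightarrow>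
   (real \<Rightarrow> real \<Rightarrow> 'q phase \<Rightarrow> 'q phase) \<Rightarrow> bool" where
  "boundary_value_flow H \<phi> W F \<longleftrightarrow>
     nbhd_of_zero_section W \<and>
     (\<forall>q0 p1 h. ((q0, p1), h) \<in> W \<longrightarrow>
        trajectory H \<phi> h (\<lambda>t. F h t (q0, p1)) \<and>
        fst (F h 0 (q0, p1)) = q0 \<and> snd (F h h (q0, p1)) = p1 \<and>
        (\<forall>z. trajectory H \<phi> h z \<and> fst (z 0) = q0 \<and> snd (z h) = p1 \<longrightarrow>
           (\<forall>t\<in>closed_segment 0 h. z t = F h t (q0, p1)))) \<and>
     (\<exists>\<Omega> G. open \<Omega> \<and> smooth_on \<Omega> G \<and>
        (\<forall>t h x. (x, h) \<in> W \<and> t \<in> closed_segment 0 h \<longrightarrow>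
           (t, h, x) \<in> \<Omega> \<and> G (t, h, x) = F h t x))"


section \<open>Families of forced discrete Hamiltonian systems\<close>

text \<open>
  Families are functions with the parameter \<open>h\<close> first, meaningful for \<open>(x, h)\<close> in an open
  neighbourhood \<open>W\<close> of \<open>T\<^sup>*Q \<times> {0}\<close>.
\<close>

definition smooth_family ::
  "('q::euclidean_space phase \<times> real) set \<Rightarrow> (real \<Rightarrow> 'q phase \<Rightarrow> real) \<Rightarrow>
   (real \<Rightarrow> 'q phase \<Rightarrow> 'q covector) \<Rightarrow> bool" where
  "smooth_family W Hd \<phi>d \<longleftrightarrow> nbhd_of_zero_section W \<and>
     smooth_on W (\<lambda>(x, h). Hd h x) \<and> smooth_on W (\<lambda>(x, h). \<phi>d h x)"

definition legendre_plus ::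
  "('q::euclidean_space phase \<Rightarrow> real) \<Rightarrow> ('q phase \<Rightarrow> 'q covector) \<Rightarrow> 'q phase \<Rightarrow> 'q phase" where
  "legendre_plus Hd \<phi>d x = (D2 Hd x - pcomp (\<phi>d x), snd x)"

definition legendre_minus ::
  "('q::euclidean_space phase \<Rightarrow> real) \<Rightarrow> ('q phase \<Rightarrow> 'q covector) \<Rightarrow> 'q phase \<Rightarrow> 'q phase" where
  "legendre_minus Hd \<phi>d x = (fst x, D1 Hd x - qcomp (\<phi>d x))"

definition legendre_minus_family ::
  "(real \<Rightarrow> 'q::euclidean_space phase \<Rightarrow> real) \<Rightarrow> (real \<Rightarrow> 'q phase \<Rightarrow> 'q covector) \<Rightarrow>
   'q phase \<times> real \<Rightarrow> 'q phase \<times> real" where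
  "legendre_minus_family Hd \<phi>d = (\<lambda>(x, h). (legendre_minus (Hd h) (\<phi>d h) x, h))"

text \<open>
  \<open>U\<close> and \<open>V\<close> are neighbourhoods between which the minus Legendre transforms are inverted; the germ of
  the resulting discrete flow along \<open>T\<^sup>*Q \<times> {0}\<close> does not depend on their choice.
\<close>

definition inversion_domains ::
  "('q::euclidean_space phase \<times> real) set \<Rightarrow> (real \<Rightarrow> 'q phase \<Rightarrow> real) \<Rightarrow>
   (real \<Rightarrow> 'q phase \<Rightarrow> 'q covector) \<Rightarrow> ('q phase \<times> real) set \<Rightarrow> ('q phase \<times> real) set \<Rightarrow> bool" where
  "inversion_domains W Hd \<phi>d U V \<longleftrightarrow> U \<subseteq> W \<and> nbhd_of_zero_section U \<and> nbhd_of_zero_section V \<and>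
     diffeo_between (legendre_minus_family Hd \<phi>d) U V"

definition discrete_flow ::
  "(real \<Rightarrow> 'q::euclidean_space phase \<Rightarrow> real) \<Rightarrow> (real \<Rightarrow> 'q phase \<Rightarrow> 'q covector) \<Rightarrow>
   ('q phase \<times> real) set \<Rightarrow> real \<Rightarrow> 'q phase \<Rightarrow> 'q phase" where
  "discrete_flow Hd \<phi>d U h y =
     legendre_plus (Hd h) (\<phi>d h) (fst (inv_into U (legendre_minus_family Hd \<phi>d) (y, h)))"


section \<open>Exact discretization, discretizations and contact order\<close>

text \<open>
  The integrals are oriented, so that \<open>h < 0\<close> is allowed.
\<close>

definition exact_H ::
  "('q::euclidean_space phase \<Rightarrow> real) \<Rightarrow> (real \<Rightarrow> real \<Rightarrow> 'q phase \<Rightarrow> 'q phase) \<Rightarrow>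
   real \<Rightarrow> 'q phase \<Rightarrow> real" where
  "exact_H H F h x =
     (if h = 0 then blinfun_apply (snd x) (fst x)
      else blinfun_apply (snd (F h h x)) (fst (F h h x)) -
        (LBINT t=ereal 0..ereal h.
           blinfun_apply (snd (F h t x)) (vector_derivative (\<lambda>s. fst (F h s x)) (at t)) -
           H (F h t x)))"

definition exact_\<phi> ::
  "('q::euclidean_space phase \<Rightarrow> 'q covector) \<Rightarrow> (real \<Rightarrow> real \<Rightarrow> 'q phase \<Rightarrow> 'q phase) \<Rightarrow>
   real \<Rightarrow> 'q phase \<Rightarrow> 'q covector" where
  "exact_\<phi> \<phi> F h x =
     (if h = 0 then 0
      else Blinfun (\<lambda>\<delta>. LBINT t=ereal 0..ereal h.
        blinfun_apply (\<phi> (F h t x)) (frechet_derivative (F h t) (at x) \<delta>)))"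

definition discretization ::
  "('q::euclidean_space phase \<Rightarrow> real) \<Rightarrow> ('q phase \<Rightarrow> 'q covector) \<Rightarrow>
   ('q phase \<times> real) set \<Rightarrow> (real \<Rightarrow> 'q phase \<Rightarrow> real) \<Rightarrow> (real \<Rightarrow> 'q phase \<Rightarrow> 'q covector) \<Rightarrow> bool" where
  "discretization H \<phi> W Hd \<phi>d \<longleftrightarrow> smooth_family W Hd \<phi>d \<and>
     equal_up_to 2 UNIV (\<lambda>h x. blinfun_apply (snd x) (fst x) + h * H x) W Hd \<and>
     equal_up_to 2 UNIV (\<lambda>h x. h *\<^sub>R \<phi> x) W \<phi>d"

text \<open>
  \<open>W\<close> is the domain of the boundary value flow \<open>F\<close>, hence of the exact discretization; \<open>Wd\<close> is the
  domain of the family \<open>(Hd, \<phi>d)\<close>.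
\<close>

definition contact_order ::
  "nat \<Rightarrow> ('q::euclidean_space phase \<Rightarrow> real) \<Rightarrow> ('q phase \<Rightarrow> 'q covector) \<Rightarrow>
   ('q phase \<times> real) set \<Rightarrow> (real \<Rightarrow> real \<Rightarrow> 'q phase \<Rightarrow> 'q phase) \<Rightarrow>
   ('q phase \<times> real) set \<Rightarrow> (real \<Rightarrow> 'q phase \<Rightarrow> real) \<Rightarrow> (real \<Rightarrow> 'q phase \<Rightarrow> 'q covector) \<Rightarrow> bool" where
  "contact_order r H \<phi> W F Wd Hd \<phi>d \<longleftrightarrow>
     equal_up_to (r + 1) W (exact_H H F) Wd Hd \<and>
     equal_up_to (r + 1) W (exact_\<phi> \<phi> F) Wd \<phi>d"

end

theory Submission
  imports Defs
begin

text \<open>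
  Inserting Hamilton's equations into the first variation of \<open>H\<^sup>E\<^bsub>d,h\<^esub>\<close> and integrating by parts gives
  \<open>dH\<^sup>E(\<delta>q\<^sub>0, \<delta>p\<^sub>1) = \<delta>p\<^sub>1 q(h) + p(0) \<delta>q\<^sub>0 + \<phi>\<^sup>E(\<delta>q\<^sub>0, \<delta>p\<^sub>1)\<close>. Hence the exact Legendre transforms send
  \<open>(q\<^sub>0, p\<^sub>1)\<close> to the two end points of the trajectory with these boundary values, and the exact discrete
  flow is the time-\<open>h\<close> flow.

  For the order, \<open>H\<^sub>d - H\<^sup>E = h\<^bsup>r+1\<^esup> \<delta>\<close> with \<open>\<delta>\<close> continuous. Both sides being smooth, Hadamard's lemma
  shows that \<open>\<delta>\<close> is smooth, so that the differentials, and therefore the Legendre transforms, agree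
  up to \<open>O(h\<^bsup>r+1\<^esup>)\<close> as well. All minus transforms are the identity at \<open>h = 0\<close>, hence diffeomorphisms near
  the zero section, and the estimate carries over to the flows.
\<close>


subsection \<open>Finite-dimensional spaces\<close>

text \<open>Momenta are covectors in the operator space
  \<open>'q \<Rightarrow>\<^sub>L real\<close>, so calculus is set up for spaces known only through
  finitely many linear coordinates. The smooth dependence of the boundary value flow is given on a
  set that is not open and whose time segment shrinks to a point at h = 0. Rescaling time to s = t /
  h replaces it by a smooth family over the fixed interval [0, 1], in which both signs of h and h =
  0 itself obey the same formulas. A neighbourhood of the zero section may become arbitrarily thin
  in h as x goes to infinity. Local inverses at single points do not suffice: injectivity has to
  hold on one open set containing all (x, 0). A remainder that is merely continuous cannot be
  differentiated in x. This forces the division by powers of h, and with it neighbourhoods that are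
  star-shaped in the h-direction.\<close>

text \<open>\<^const>\<open>bounded_linear\<close> cannot be applied to the type of a class under definition, hence the
  unfolded form.\<close>

class finite_dim = banach + heine_borel +
  assumes ex_coordinates_raw: "\<exists>B c. finite B \<and>
    (\<forall>b x y. c b (x + y) = c b x + (c b y :: real)) \<and> (\<forall>b r x. c b (r *\<^sub>R x) = r * c b x) \<and>
    (\<forall>b. \<exists>K. \<forall>x. \<bar>c b x\<bar> \<le> norm x * K) \<and> (\<forall>x. x = (\<Sum>b\<in>B. c b x *\<^sub>R b))"

lemma ex_coordinates: "\<exists>B (c :: 'a::finite_dim \<Rightarrow> 'a \<Rightarrow> real). finite B \<and> (\<forall>b. bounded_linear (c b)) \<and>
    (\<forall>x. x = (\<Sum>b\<in>B. c b x *\<^sub>R b))"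
proof -
  obtain B and c :: "'a \<Rightarrow> 'a \<Rightarrow> real" where B: "finite B" "\<And>b x y. c b (x + y) = c b x + c b y"
    "\<And>b r x. c b (r *\<^sub>R x) = r * c b x" "\<And>b. \<exists>K. \<forall>x. \<bar>c b x\<bar> \<le> norm x * K"
    "\<forall>x. x = (\<Sum>b\<in>B. c b x *\<^sub>R b)"
    using ex_coordinates_raw[where 'a='a] by auto
  have "bounded_linear (c b)" for b
  proof -
    obtain K where "\<And>x. \<bar>c b x\<bar> \<le> norm x * K"
      using B(4)[of b] by blast
    then show ?thesis
      by (intro bounded_linear_intro[of "c b" K]) (simp_all add: B(2,3))
  qed
  with B(1,5) show ?thesis by blast
qed

lemma coordinates_raw:
  assumes "\<exists>B c. finite B \<and> (\<forall>b. bounded_linear (c b)) \<and>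
    (\<forall>x::'a. x = (\<Sum>b\<in>B. c b x *\<^sub>R b))"
  shows "\<exists>B c. finite B \<and>
    (\<forall>b x y. c b (x + y) = c b x + (c b y :: real)) \<and> (\<forall>b r x. c b (r *\<^sub>R x) = r * c b x) \<and>
    (\<forall>b. \<exists>K. \<forall>x. \<bar>c b x\<bar> \<le> norm x * K) \<and>
    (\<forall>x::'a::real_normed_vector. x = (\<Sum>b\<in>B. c b x *\<^sub>R b))"
proof -
  obtain B and c :: "'a \<Rightarrow> 'a \<Rightarrow> real" where B: "finite B" "\<And>b. bounded_linear (c b)"
    "\<forall>x. x = (\<Sum>b\<in>B. c b x *\<^sub>R b)"
    using assms by auto
  show ?thesis
  proof (rule exI[of _ B], rule exI[of _ c], intro conjI allI)
    fix b x y and r :: real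
    show "c b (x + y) = c b x + c b y" "c b (r *\<^sub>R x) = r * c b x"
      using bounded_linear.linear[OF B(2)[of b]] by (simp_all add: linear_add linear_cmul)
    show "\<exists>K. \<forall>x. \<bar>c b x\<bar> \<le> norm x * K"
      using bounded_linear.bounded[OF B(2)[of b]] by (simp only: real_norm_def)
  qed (use B(1,3) in auto)
qed

instance euclidean_space \<subseteq> finite_dim
proof (standard, rule coordinates_raw)
  show "\<exists>B c. finite B \<and> (\<forall>b. bounded_linear (c b)) \<and> (\<forall>x::'a. x = (\<Sum>b\<in>B. c b x *\<^sub>R b))"
    by (rule exI[of _ Basis], rule exI[of _ "\<lambda>b x. x \<bullet> b"])
      (simp add: euclidean_representation bounded_linear_inner_left)
qed

instance prod :: (finite_dim, finite_dim) finite_dim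
proof (standard, rule coordinates_raw)
  obtain B1 and c1 :: "'a \<Rightarrow> 'a \<Rightarrow> real" where 1: "finite B1" "\<And>b. bounded_linear (c1 b)"
    "\<And>x. x = (\<Sum>b\<in>B1. c1 b x *\<^sub>R b)"
    using ex_coordinates[where 'a='a] by blast
  obtain B2 and c2 :: "'b \<Rightarrow> 'b \<Rightarrow> real" where 2: "finite B2" "\<And>b. bounded_linear (c2 b)"
    "\<And>x. x = (\<Sum>b\<in>B2. c2 b x *\<^sub>R b)"
    using ex_coordinates[where 'a='b] by blast
  \<comment> \<open>A coordinate family may contain the vector 0. Deleting it from the second copy
    makes the two copies disjoint and lets the test \<open>b2 = 0\<close> tell them apart; the
    deleted term contributes nothing.\<close>
  let ?B = "(\<lambda>b. (b, 0)) ` B1 \<union> (\<lambda>b. (0, b)) ` (B2 - {0})"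
  let ?c = "\<lambda>(b1, b2) (x1, x2). if b2 = 0 then c1 b1 x1 else c2 b2 x2"
  have lin: "bounded_linear (?c b)" for b
  proof (cases "snd b = 0")
    case True
    then have "?c b = (\<lambda>x. c1 (fst b) (fst x))"
      by (auto simp: split_beta)
    then show ?thesis
      using bounded_linear_compose[OF 1(2) bounded_linear_fst] by (simp only:)
  next
    case False
    then have "?c b = (\<lambda>x. c2 (snd b) (snd x))"
      by (auto simp: split_beta)
    then show ?thesis
      using bounded_linear_compose[OF 2(2) bounded_linear_snd] by (simp only:)
  qed
  have "(\<Sum>b\<in>?B. ?c b x *\<^sub>R b) = x" for x
  proof -
    have "(\<Sum>b\<in>?B. ?c b x *\<^sub>R b) = (\<Sum>b\<in>(\<lambda>b. (b, 0)) ` B1. ?c b x *\<^sub>R b) +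
        (\<Sum>b\<in>(\<lambda>b. (0, b)) ` (B2 - {0}). ?c b x *\<^sub>R b)"
      using 1(1) 2(1) by (intro sum.union_disjoint) auto
    also have "(\<Sum>b\<in>(\<lambda>b. (b, 0)) ` B1. ?c b x *\<^sub>R b) = (\<Sum>b\<in>B1. (c1 b (fst x) *\<^sub>R b, 0))"
      by (subst sum.reindex) (auto simp: inj_on_def split_beta)
    also have "\<dots> = (fst x, 0)"
      using 1(3)[of "fst x"] by (simp add: sum_prod)
    also have "(\<Sum>b\<in>(\<lambda>b. (0, b)) ` (B2 - {0}). ?c b x *\<^sub>R b)
        = (\<Sum>b\<in>B2 - {0}. (0, c2 b (snd x) *\<^sub>R b))"
      by (subst sum.reindex) (auto simp: inj_on_def split_beta intro!: sum.cong)
    also have "\<dots> = (\<Sum>b\<in>B2. (0, c2 b (snd x) *\<^sub>R b))"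
      using 2(1) by (intro sum.mono_neutral_left) (auto simp: zero_prod_def)
    also have "\<dots> = (0, snd x)"
      using 2(3)[of "snd x"] by (simp add: sum_prod)
    finally show ?thesis by simp
  qed
  then show "\<exists>B c. finite B \<and> (\<forall>b. bounded_linear (c b)) \<and> (\<forall>x::'a \<times> 'b. x = (\<Sum>b\<in>B. c b x *\<^sub>R b))"
    using 1(1) 2(1) lin by (intro exI[of _ ?B] exI[of _ ?c]) auto
qed

text \<open>Through this instance phase space, whose second factor consists of covectors, becomes an
  admissible domain for the chain rule. The coordinates are matrix entries along the rank-one maps v
  \<mapsto> (v \<bullet> j) i; injectivity of \<open>?e\<close> allows the index pair to be
  recovered from the map.\<close>

instance blinfun :: (euclidean_space, euclidean_space) finite_dim
proof (standard, rule coordinates_raw)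
  let ?e = "\<lambda>(i, j). blinfun_scaleR_left i o\<^sub>L blinfun_inner_left j :: 'a \<Rightarrow>\<^sub>L 'b"
  let ?P = "Basis \<times> Basis :: ('b \<times> 'a) set"
  have e: "blinfun_apply (?e (i, j)) v = (v \<bullet> j) *\<^sub>R i" for i j v
    by simp
  have inj: "inj_on ?e ?P"
  proof (rule inj_onI, clarsimp)
    fix i i' :: 'b and j j' :: 'a
    assume b: "i \<in> Basis" "i' \<in> Basis" "j \<in> Basis" "j' \<in> Basis"
      and "blinfun_scaleR_left i o\<^sub>L blinfun_inner_left j = blinfun_scaleR_left i' o\<^sub>L blinfun_inner_left j'"
    then have "(j \<bullet> j) *\<^sub>R i = (j \<bullet> j') *\<^sub>R i'"
      using e[of i j j] e[of i' j' j] by simp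
    then show "i = i' \<and> j = j'"
      using b by (auto simp: inner_Basis split: if_splits)
  qed
  let ?d = "\<lambda>(i, j) (l :: 'a \<Rightarrow>\<^sub>L 'b). blinfun_apply l j \<bullet> i"
  let ?c = "\<lambda>b. ?d (inv_into ?P ?e b)"
  have lin: "bounded_linear (?d p)" for p
    by (cases p) (auto intro!: bounded_linear_compose[OF bounded_linear_inner_left]
        blinfun.bounded_linear_left)
  have "l = (\<Sum>b\<in>?e ` ?P. ?c b l *\<^sub>R b)" for l
  proof (rule blinfun_eqI)
    fix v
    have "(\<Sum>b\<in>?e ` ?P. ?c b l *\<^sub>R b) = (\<Sum>p\<in>?P. ?d p l *\<^sub>R ?e p)"
      by (subst sum.reindex[OF inj]) (auto intro!: sum.cong simp: inv_into_f_f[OF inj])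
    also have "blinfun_apply \<dots> v = (\<Sum>(i, j)\<in>?P. ((v \<bullet> j) * (blinfun_apply l j \<bullet> i)) *\<^sub>R i)"
      by (simp add: blinfun.sum_left blinfun.scaleR_left split_beta mult.commute)
    also have "\<dots> = (\<Sum>i\<in>Basis. (\<Sum>j\<in>Basis. (v \<bullet> j) * (blinfun_apply l j \<bullet> i)) *\<^sub>R i)"
      by (simp add: sum.cartesian_product[symmetric] scaleR_sum_left)
    also have "\<dots> = (\<Sum>i\<in>Basis. (blinfun_apply l (\<Sum>j\<in>Basis. (v \<bullet> j) *\<^sub>R j) \<bullet> i) *\<^sub>R i)"
      by (simp only: blinfun.sum_right blinfun.scaleR_right inner_sum_left inner_scaleR_left)
    also have "\<dots> = blinfun_apply l v"
      by (simp add: euclidean_representation)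
    finally show "blinfun_apply l v = blinfun_apply (\<Sum>b\<in>?e ` ?P. ?c b l *\<^sub>R b) v" ..
  qed
  then show "\<exists>B c. finite B \<and> (\<forall>b. bounded_linear (c b)) \<and> (\<forall>x::'a \<Rightarrow>\<^sub>L 'b. x = (\<Sum>b\<in>B. c b x *\<^sub>R b))"
    using lin by (intro exI[of _ "?e ` ?P"] exI[of _ ?c]) (auto simp: split_beta)
qed


subsection \<open>Calculus of smooth maps\<close>

lemma Ck_on_subset: "Ck_on n S f \<Longrightarrow> T \<subseteq> S \<Longrightarrow> Ck_on n T f"
  by (induction n arbitrary: f) (auto intro: continuous_on_subset)

lemma Ck_on_cong:
  assumes "Ck_on n S f" "open S" "\<And>x. x \<in> S \<Longrightarrow> f x = g x"
  shows "Ck_on n S g"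
  using assms
proof (induction n arbitrary: f g)
  case 0
  then show ?case using continuous_on_cong by (metis Ck_on.simps(1))
next
  case (Suc n)
  have D: "(g has_derivative frechet_derivative f (at x)) (at x)" if "x \<in> S" for x
  proof (rule has_derivative_transform_within_open[OF _ Suc.prems(2) that Suc.prems(3)])
    show "(f has_derivative frechet_derivative f (at x)) (at x)"
      using Suc.prems(1) that by (auto simp: frechet_derivative_works)
  qed
  then have "frechet_derivative g (at x) = frechet_derivative f (at x)" if "x \<in> S" for x
    using that by (metis frechet_derivative_at)
  with Suc.IH[of "\<lambda>x. frechet_derivative f (at x) v" "\<lambda>x. frechet_derivative g (at x) v" for v]
  show ?case
    using Suc.prems(1,2) D by (auto simp: differentiable_def)
qed

text \<open>Lets an explicit formula stand in for \<open>frechet_derivative\<close>, which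
  \<open>Ck_on\<close> mentions literally. Openness enters because equality of maps on a set passes
  to derivatives only at interior points.\<close>

lemma Ck_on_SucI:
  assumes "open S" "\<And>x. x \<in> S \<Longrightarrow> (f has_derivative f' x) (at x)" "\<And>v. Ck_on n S (\<lambda>x. f' x v)"
  shows "Ck_on (Suc n) S f"
proof -
  have "frechet_derivative f (at x) = f' x" if "x \<in> S" for x
    using frechet_derivative_at[OF assms(2)[OF that]] by simp
  then have "Ck_on n S (\<lambda>x. frechet_derivative f (at x) v)" for v
    by (intro Ck_on_cong[OF assms(3)[of v] assms(1)]) auto
  with assms(2) show ?thesis by (auto simp: differentiable_def)
qed

lemma Ck_on_has_derivative:
  assumes "Ck_on (Suc n) S f" "x \<in> S"
  shows "(f has_derivative frechet_derivative f (at x)) (at x)"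
  using assms by (auto simp: frechet_derivative_works)

lemma Ck_on_Suc_imp: "Ck_on (Suc n) S f \<Longrightarrow> Ck_on n S f"
proof (induction n arbitrary: f)
  case 0
  then show ?case
    by (auto intro!: continuous_at_imp_continuous_on differentiable_imp_continuous_within)
next
  case (Suc n)
  then show ?case by (auto simp del: Ck_on.simps(1))
qed

lemma Ck_on_continuous: "Ck_on n S f \<Longrightarrow> continuous_on S f"
  by (induction n) (auto dest: Ck_on_Suc_imp simp del: Ck_on.simps(2))

lemma Ck_on_const: "open S \<Longrightarrow> Ck_on n S (\<lambda>x. c)"
proof (induction n arbitrary: c)
  case (Suc n)
  then show ?case by (intro Ck_on_SucI[where f' = "\<lambda>x v. 0"]) auto
qed auto

lemma Ck_on_add: "open S \<Longrightarrow> Ck_on n S f \<Longrightarrow> Ck_on n S g \<Longrightarrow> Ck_on n S (\<lambda>x. f x + g x)"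
proof (induction n arbitrary: f g)
  case (Suc n)
  then show ?case
    by (intro Ck_on_SucI[where f' = "\<lambda>x v. frechet_derivative f (at x) v + frechet_derivative g (at x) v"])
      (auto intro!: has_derivative_add Ck_on_has_derivative simp del: Ck_on.simps
        simp: Ck_on.simps(2)[THEN iffD1])
qed (auto intro: continuous_intros)

lemma Ck_on_linear:
  assumes L: "bounded_linear L"
  shows "open S \<Longrightarrow> Ck_on n S f \<Longrightarrow> Ck_on n S (\<lambda>x. L (f x))"
proof (induction n arbitrary: f)
  case 0
  then show ?case using bounded_linear.continuous_on[OF L] by auto
next
  case (Suc n)
  then show ?case
    by (intro Ck_on_SucI[where f' = "\<lambda>x v. L (frechet_derivative f (at x) v)"])
      (auto intro!: bounded_linear.has_derivative[OF L] Ck_on_has_derivative simp del: Ck_on.simps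
        simp: Ck_on.simps(2)[THEN iffD1])
qed

lemma Ck_on_bilinear:
  assumes L: "bounded_bilinear L"
  shows "open S \<Longrightarrow> Ck_on n S f \<Longrightarrow> Ck_on n S g \<Longrightarrow> Ck_on n S (\<lambda>x. L (f x) (g x))"
proof (induction n arbitrary: f g)
  case 0
  then show ?case using bounded_bilinear.continuous_on[OF L] by auto
next
  case (Suc n)
  have "Ck_on n S f" "Ck_on n S g"
    using Suc.prems by (auto intro: Ck_on_Suc_imp simp del: Ck_on.simps)
  with Suc show ?case
    by (intro Ck_on_SucI[where f' = "\<lambda>x v. L (f x) (frechet_derivative g (at x) v) +
          L (frechet_derivative f (at x) v) (g x)"])
      (auto intro!: bounded_bilinear.FDERIV[OF L] Ck_on_has_derivative Ck_on_add simp del: Ck_on.simps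
        simp: Ck_on.simps(2)[THEN iffD1])
qed

lemma Ck_on_ident: "open S \<Longrightarrow> Ck_on n S (\<lambda>x. x)"
proof (cases n)
  case (Suc m)
  then show "open S \<Longrightarrow> ?thesis"
    using Ck_on_SucI[of S "\<lambda>x. x" "\<lambda>x v. v" m] Ck_on_const by auto
qed auto

lemma Ck_on_Pair: 
  assumes "open S" "Ck_on n S f" "Ck_on n S g"
  shows "Ck_on n S (\<lambda>x. (f x, g x))"
proof -
  have "Ck_on n S (\<lambda>x. (f x, 0) + (0, g x))"
    using assms by (intro Ck_on_add Ck_on_linear[where L = "\<lambda>u. (u, 0)"]
        Ck_on_linear[where L = "\<lambda>u. (0, u)"] bounded_linear_Pair bounded_linear_ident
        bounded_linear_zero)
  then show ?thesis by simp
qed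

lemma Ck_on_sum: "open S \<Longrightarrow> (\<And>i. i \<in> I \<Longrightarrow> Ck_on n S (f i)) \<Longrightarrow> Ck_on n S (\<lambda>x. \<Sum>i\<in>I. f i x)"
  by (induction I rule: infinite_finite_induct) (auto intro: Ck_on_add Ck_on_const)

lemma coordinates:
  obtains B and c :: "'a::finite_dim \<Rightarrow> 'a \<Rightarrow>\<^sub>L real"
  where "finite B" "\<And>x. x = (\<Sum>b\<in>B. blinfun_apply (c b) x *\<^sub>R b)"
proof -
  obtain B and c :: "'a \<Rightarrow> 'a \<Rightarrow> real" where B: "finite B" "\<And>b. bounded_linear (c b)"
    "\<And>x. x = (\<Sum>b\<in>B. c b x *\<^sub>R b)"
    using ex_coordinates[where 'a='a] by blast
  from B(3) have "x = (\<Sum>b\<in>B. blinfun_apply (Blinfun (c b)) x *\<^sub>R b)" for x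
    by (simp only: bounded_linear_Blinfun_apply[OF B(2)])
  with B(1) show ?thesis by (rule that)
qed

text \<open>The chain rule differentiates \<open>g\<close> in a direction that varies with the
  point, whereas \<open>Ck_on\<close> controls fixed directions only. Expanding the direction in
  coordinates gives a finite sum of products to which the induction hypothesis applies; hence the
  finite-dimensional domain of \<open>g\<close>.\<close>

lemma Ck_on_compose:
  fixes g :: "'b::finite_dim \<Rightarrow> 'c::real_normed_vector"
  shows "open S \<Longrightarrow> open T \<Longrightarrow> f ` S \<subseteq> T \<Longrightarrow> Ck_on n S f \<Longrightarrow> Ck_on n T g \<Longrightarrow> Ck_on n S (\<lambda>x. g (f x))"
proof (induction n arbitrary: g)
  case 0
  then show ?case by (auto intro: continuous_on_compose2)
next
  case (Suc n)
  obtain B and c :: "'b \<Rightarrow> 'b \<Rightarrow>\<^sub>L real" where B: "finite B"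
    "\<And>x. x = (\<Sum>b\<in>B. blinfun_apply (c b) x *\<^sub>R b)"
    using coordinates by blast
  let ?D = "\<lambda>x v. \<Sum>b\<in>B. blinfun_apply (c b) (frechet_derivative f (at x) v) *\<^sub>R
    frechet_derivative g (at (f x)) b"
  have "((\<lambda>x. g (f x)) has_derivative ?D x) (at x)" if x: "x \<in> S" for x
  proof -
    have g: "(g has_derivative frechet_derivative g (at (f x))) (at (f x))"
      using Suc.prems x by (intro Ck_on_has_derivative) auto
    then have lin: "linear (frechet_derivative g (at (f x)))"
      using has_derivative_linear by blast
    have "(\<lambda>v. frechet_derivative g (at (f x)) (frechet_derivative f (at x) v)) = ?D x"
    proof
      fix v
      show "frechet_derivative g (at (f x)) (frechet_derivative f (at x) v) = ?D x v"
        by (subst B(2)[of "frechet_derivative f (at x) v"])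
          (simp only: linear_sum[OF lin] linear_cmul[OF lin])
    qed
    moreover have "((\<lambda>x. g (f x)) has_derivative
        (\<lambda>v. frechet_derivative g (at (f x)) (frechet_derivative f (at x) v))) (at x)"
      using Suc.prems x g
      by (intro has_derivative_compose[of f "frechet_derivative f (at x)" x UNIV g]
          Ck_on_has_derivative) auto
    ultimately show ?thesis by simp
  qed
  moreover have "Ck_on n S (\<lambda>x. ?D x v)" for v
  proof (intro Ck_on_sum Ck_on_bilinear[OF bounded_bilinear_scaleR]
      Ck_on_linear[OF blinfun.bounded_linear_right] Suc.prems(1))
    fix b
    show "Ck_on n S (\<lambda>x. frechet_derivative f (at x) v)"
      using Suc.prems(4) by simp
    show "Ck_on n S (\<lambda>x. frechet_derivative g (at (f x)) b)"
      using Suc.prems by (intro Suc.IH Ck_on_Suc_imp[of n S f]) auto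
  qed
  ultimately show ?case using Suc.prems(1) by (intro Ck_on_SucI) auto
qed

lemma smooth_on_subset: "smooth_on S f \<Longrightarrow> T \<subseteq> S \<Longrightarrow> smooth_on T f"
  by (auto simp: smooth_on_def intro: Ck_on_subset)

lemma smooth_on_cong:
  assumes "smooth_on S f" "open S" "\<And>x. x \<in> S \<Longrightarrow> f x = g x"
  shows "smooth_on S g"
  using assms by (auto simp: smooth_on_def intro: Ck_on_cong)

lemma smooth_on_continuous: "smooth_on S f \<Longrightarrow> continuous_on S f"
  using Ck_on_continuous by (auto simp: smooth_on_def)

lemma smooth_on_has_derivative:
  "smooth_on S f \<Longrightarrow> x \<in> S \<Longrightarrow> (f has_derivative frechet_derivative f (at x)) (at x)"
  using Ck_on_has_derivative[of 0 S f x] by (simp only: smooth_on_def)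

lemma smooth_on_derivative: "smooth_on S f \<Longrightarrow> smooth_on S (\<lambda>x. frechet_derivative f (at x) v)"
  unfolding smooth_on_def using Ck_on.simps(2) by blast

lemma smooth_on_const: "open S \<Longrightarrow> smooth_on S (\<lambda>x. c)"
  and smooth_on_ident: "open S \<Longrightarrow> smooth_on S (\<lambda>x. x)"
  and smooth_on_linear:
    "bounded_linear L \<Longrightarrow> open S \<Longrightarrow> smooth_on S f \<Longrightarrow> smooth_on S (\<lambda>x. L (f x))"
  and smooth_on_bilinear: "bounded_bilinear b \<Longrightarrow> open S \<Longrightarrow> smooth_on S f \<Longrightarrow> smooth_on S f2 \<Longrightarrow>
    smooth_on S (\<lambda>x. b (f x) (f2 x))"
  and smooth_on_Pair:
    "open S \<Longrightarrow> smooth_on S f \<Longrightarrow> smooth_on S f1 \<Longrightarrow> smooth_on S (\<lambda>x. (f x, f1 x))"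
  and smooth_on_add:
    "open S \<Longrightarrow> smooth_on S f \<Longrightarrow> smooth_on S f3 \<Longrightarrow> smooth_on S (\<lambda>x. f x + f3 x)"
  and smooth_on_sum:
    "open S \<Longrightarrow> (\<And>i. i \<in> I \<Longrightarrow> smooth_on S (F i)) \<Longrightarrow> smooth_on S (\<lambda>x. \<Sum>i\<in>I. F i x)"
  by (auto simp: smooth_on_def intro: Ck_on_const Ck_on_ident Ck_on_linear Ck_on_bilinear Ck_on_Pair
      Ck_on_add Ck_on_sum)

lemma smooth_on_diff:
  "open S \<Longrightarrow> smooth_on S f \<Longrightarrow> smooth_on S g \<Longrightarrow> smooth_on S (\<lambda>x. f x - g x)"
  using smooth_on_add[of S f "\<lambda>x. - g x"]
    smooth_on_linear[OF bounded_linear_minus[OF bounded_linear_ident], of S g] by simp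

lemma smooth_on_compose:
  fixes g :: "'b::finite_dim \<Rightarrow> 'c::real_normed_vector"
  assumes "smooth_on T g" "open T" "open S" "smooth_on S f" "f ` S \<subseteq> T"
  shows "smooth_on S (\<lambda>x. g (f x))"
  using assms by (auto simp: smooth_on_def intro: Ck_on_compose)

lemma smooth_on_fst: "open S \<Longrightarrow> smooth_on S f \<Longrightarrow> smooth_on S (\<lambda>x. fst (f x))"
  and smooth_on_snd: "open S \<Longrightarrow> smooth_on S f \<Longrightarrow> smooth_on S (\<lambda>x. snd (f x))"
  by (auto intro: smooth_on_linear bounded_linear_fst bounded_linear_snd)

section \<open>Derivatives as operator-valued maps\<close>

definition blinfun_deriv :: "('a::real_normed_vector \<Rightarrow> 'b::real_normed_vector) \<Rightarrow> 'a \<Rightarrow> 'a \<Rightarrow>\<^sub>L 'b" where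
  "blinfun_deriv f x = Blinfun (frechet_derivative f (at x))"

lemma blinfun_deriv_apply:
  "f differentiable (at x) \<Longrightarrow> blinfun_apply (blinfun_deriv f x) = frechet_derivative f (at x)"
  unfolding blinfun_deriv_def
  by (intro bounded_linear_Blinfun_apply) (simp add: frechet_derivative_works has_derivative_bounded_linear)

lemma smooth_on_differentiable: "smooth_on S f \<Longrightarrow> x \<in> S \<Longrightarrow> f differentiable (at x)"
  using smooth_on_has_derivative differentiable_def by blast

lemma smooth_on_has_blinfun_deriv:
  "smooth_on S f \<Longrightarrow> x \<in> S \<Longrightarrow> (f has_derivative blinfun_apply (blinfun_deriv f x)) (at x)"
  using smooth_on_has_derivative smooth_on_differentiable blinfun_deriv_apply by metis

text \<open>Smoothness of single directional derivatives becomes smoothness in the operator norm by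
  writing the derivative as a finite sum of rank-one operators whose coefficients are directional
  derivatives.\<close>

lemma smooth_on_blinfun_deriv:
  fixes f :: "'a::finite_dim \<Rightarrow> 'b::real_normed_vector"
  assumes "smooth_on S f" "open S"
  shows "smooth_on S (blinfun_deriv f)"
proof -
  obtain B and c :: "'a \<Rightarrow> 'a \<Rightarrow>\<^sub>L real" where B: "finite B"
    "\<And>x. x = (\<Sum>b\<in>B. blinfun_apply (c b) x *\<^sub>R b)"
    using coordinates by blast
  let ?D = "\<lambda>x. \<Sum>b\<in>B. blinfun_scaleR_left (frechet_derivative f (at x) b) o\<^sub>L c b"
  have "?D x = blinfun_deriv f x" if "x \<in> S" for x
  proof (rule blinfun_eqI)
    fix v
    have lin: "linear (frechet_derivative f (at x))"
      using smooth_on_has_derivative[OF assms(1) that] has_derivative_linear by blast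
    have "blinfun_apply (blinfun_deriv f x) v = frechet_derivative f (at x) (\<Sum>b\<in>B. blinfun_apply (c b) v *\<^sub>R b)"
      using B(2)[of v] blinfun_deriv_apply[OF smooth_on_differentiable[OF assms(1) that]] by simp
    also have "\<dots> = blinfun_apply (?D x) v"
      by (simp add: linear_sum[OF lin] linear_cmul[OF lin] blinfun.sum_left)
    finally show "blinfun_apply (?D x) v = blinfun_apply (blinfun_deriv f x) v" ..
  qed
  moreover have "smooth_on S ?D"
    by (intro smooth_on_sum smooth_on_linear[OF bounded_bilinear.bounded_linear_left[OF
            bounded_bilinear_blinfun_compose]]
        smooth_on_linear[OF bounded_linear_blinfun_scaleR_left] smooth_on_derivative assms)
  ultimately show ?thesis using smooth_on_cong assms(2) by blast
qed


subsection \<open>Integrals depending on a parameter\<close>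

text \<open>\<open>E\<close> embeds parameter directions as \<open>(0, v)\<close>; the joint
  continuity of \<open>blinfun_deriv f\<close> along it is the hypothesis under which the Leibniz
  rule permits differentiation under the integral.\<close>

lemma has_derivative_param_integral:
  fixes f :: "real \<times> 'a::finite_dim \<Rightarrow> 'b::banach"
  assumes f: "smooth_on S f" "open S" and U: "{a..b} \<times> U \<subseteq> S" "open U" "x \<in> U"
  shows "((\<lambda>x. integral {a..b} (\<lambda>s. f (s, x))) has_derivative
    (\<lambda>v. integral {a..b} (\<lambda>s. frechet_derivative f (at (s, x)) (0, v)))) (at x)"
proof -
  define E :: "'a \<Rightarrow>\<^sub>L (real \<times> 'a)" where "E = Blinfun (Pair 0)"
  have E: "blinfun_apply E = Pair 0"
    unfolding E_def
    by (intro bounded_linear_Blinfun_apply bounded_linear_Pair bounded_linear_zero bounded_linear_ident)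
  \<comment> \<open>The Leibniz rule asks for a convex parameter set, hence the ball.\<close>
  obtain e where e: "e > 0" "ball x e \<subseteq> U"
    using U open_contains_ball by blast
  have S: "(s, y) \<in> S" if "s \<in> {a..b}" "y \<in> ball x e" for s y
    using that e U by blast
  let ?D = "\<lambda>y s. blinfun_deriv f (s, y) o\<^sub>L E"
  have D: "((\<lambda>y. f (s, y)) has_derivative blinfun_apply (?D y s)) (at y)"
    if "s \<in> {a..b}" "y \<in> ball x e" for s y
  proof -
    have "((\<lambda>y. f (s, y)) has_derivative (\<lambda>v. blinfun_apply (blinfun_deriv f (s, y)) (0, v))) (at y)"
      using smooth_on_has_blinfun_deriv[OF f(1) S[OF that]]
      by (intro has_derivative_compose[of "Pair s" _ y UNIV f]) (auto intro!: derivative_eq_intros)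
    then show ?thesis by (simp add: E comp_def blinfun_compose.rep_eq)
  qed
  have cont: "continuous_on (ball x e \<times> cbox a b) (\<lambda>(y, s). ?D y s)"
    unfolding split_beta
    by (intro continuous_intros continuous_on_compose2[OF smooth_on_continuous[OF
            smooth_on_blinfun_deriv[OF f]]]) (use S in auto)
  have "((\<lambda>y. integral (cbox a b) (\<lambda>s. f (s, y))) has_derivative
      blinfun_apply (integral (cbox a b) (?D x))) (at x within ball x e)"
  proof (rule leibniz_rule[OF _ _ cont])
    fix y assume y: "y \<in> ball x e"
    show "(\<lambda>s. f (s, y)) integrable_on cbox a b"
      by (intro integrable_continuous continuous_on_compose2[OF smooth_on_continuous[OF f(1)]]
          continuous_intros) (use S y in auto)
    show "((\<lambda>y. f (s, y)) has_derivative blinfun_apply (?D y s)) (at y within ball x e)"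
      if "s \<in> cbox a b" for s
      using D that y by (auto intro: has_derivative_at_withinI)
  qed (use e in auto)
  moreover have "blinfun_apply (integral (cbox a b) (?D x)) =
      (\<lambda>v. integral {a..b} (\<lambda>s. frechet_derivative f (at (s, x)) (0, v)))"
  proof
    fix v
    have "?D x integrable_on cbox a b"
      by (intro integrable_continuous continuous_on_compose2[OF cont, of _ "\<lambda>s. (x, s)", simplified]
          continuous_intros) (use e in auto)
    then have "blinfun_apply (integral (cbox a b) (?D x)) v = integral (cbox a b) (\<lambda>s. ?D x s v)"
      by (rule blinfun_apply_integral)
    also have "\<dots> = integral {a..b} (\<lambda>s. frechet_derivative f (at (s, x)) (0, v))"
      using blinfun_deriv_apply[OF smooth_on_differentiable[OF f(1) S]] e
      unfolding cbox_interval by (intro integral_cong) (auto simp: E)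
    finally show "blinfun_apply (integral (cbox a b) (?D x)) v =
      integral {a..b} (\<lambda>s. frechet_derivative f (at (s, x)) (0, v))" .
  qed
  ultimately show ?thesis
    using e by (simp add: at_within_open[of x "ball x e"])
qed

text \<open>The derivative of the integral in direction \<open>v\<close> is the integral of the
  derivative of \<open>f\<close> in direction \<open>(0, v)\<close>, whose integrand is again
  smooth; so the induction runs over all \<open>f\<close> at once.\<close>

lemma smooth_on_param_integral:
  fixes f :: "real \<times> 'a::finite_dim \<Rightarrow> 'b::banach"
  assumes f: "smooth_on S f" and S: "open S" "{a..b} \<times> U \<subseteq> S" "open U"
  shows "smooth_on U (\<lambda>x. integral {a..b} (\<lambda>s. f (s, x)))"
proof -
  have "Ck_on n U (\<lambda>x. integral {a..b} (\<lambda>s. f (s, x)))" for n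
    using f
  proof (induction n arbitrary: f)
    case 0
    then show ?case
      using has_derivative_continuous[OF has_derivative_param_integral[OF _ S]]
      by (auto intro!: continuous_at_imp_continuous_on)
  next
    case (Suc n)
    show ?case
      by (rule Ck_on_SucI[OF S(3) has_derivative_param_integral[OF Suc.prems S]])
        (auto intro!: Suc.IH smooth_on_derivative Suc.prems)
  qed
  then show ?thesis by (simp add: smooth_on_def)
qed


subsection \<open>Division by powers of the parameter\<close>

text \<open>Hadamard's lemma: the quotient is the mean of the h-derivative of \<open>f\<close> over
  the segment from \<open>(x, 0)\<close> to \<open>(x, h)\<close>, an integral that stays smooth
  across \<open>h = 0\<close>.\<close>

lemma ex_smooth_quotient:
  fixes f :: "'a::finite_dim \<times> real \<Rightarrow> 'b::banach"
  assumes f: "smooth_on U f" and U: "open U"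
    and star: "\<And>x h s. (x, h) \<in> U \<Longrightarrow> s \<in> {0..1} \<Longrightarrow> (x, s * h) \<in> U"
    and zero: "\<And>x h. (x, h) \<in> U \<Longrightarrow> f (x, 0) = 0"
  obtains g where "smooth_on U g" "\<And>x h. (x, h) \<in> U \<Longrightarrow> f (x, h) = h *\<^sub>R g (x, h)"
proof
  let ?m = "\<lambda>(s, x, h). (x, s * h) :: 'a \<times> real"
  let ?S = "?m -` U"
  let ?F = "\<lambda>p. frechet_derivative f (at (?m p)) (0, 1)"
  let ?g = "\<lambda>z. integral {0..1} (\<lambda>s. ?F (s, z))"
  have S: "open ?S"
    unfolding split_beta by (intro open_vimage[OF U] continuous_intros)
  have "smooth_on ?S (\<lambda>p. (fst (snd p), fst p * snd (snd p)))"
    by (intro smooth_on_Pair smooth_on_bilinear[OF bounded_bilinear_mult] smooth_on_fst smooth_on_snd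
        smooth_on_ident S)
  then have "smooth_on ?S ?F"
    using smooth_on_compose[OF smooth_on_derivative[OF f, of "(0, 1)"] U S]
    by (auto simp: split_beta image_subset_iff)
  then show "smooth_on U ?g"
    by (rule smooth_on_param_integral[OF _ S _ U]) (use star in auto)
  fix x h assume xh: "(x, h) \<in> U"
  have "((\<lambda>s. f (x, s * h)) has_vector_derivative h *\<^sub>R ?F (s, x, h)) (at s within {0..1})"
    if "s \<in> {0..1}" for s
  proof -
    have D: "(f has_derivative frechet_derivative f (at (x, s * h))) (at (x, s * h))"
      by (rule smooth_on_has_derivative[OF f star[OF xh that]])
    have "((\<lambda>s. f (x, s * h)) has_derivative
        (\<lambda>t. frechet_derivative f (at (x, s * h)) (0, t * h))) (at s within {0..1})"
      using D by (intro has_derivative_compose[of "\<lambda>s. (x, s * h)" "\<lambda>t. (0, t * h)" s "{0..1}" f])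
        (auto intro!: derivative_eq_intros)
    moreover have "frechet_derivative f (at (x, s * h)) (0, t * h) = t *\<^sub>R h *\<^sub>R ?F (s, x, h)" for t
      using linear_cmul[OF has_derivative_linear[OF D], of "t * h" "(0, 1)"] by simp
    ultimately show ?thesis by (simp add: has_vector_derivative_def)
  qed
  then have "((\<lambda>s. h *\<^sub>R ?F (s, x, h)) has_integral f (x, 1 * h) - f (x, 0 * h)) {0..1}"
    by (intro fundamental_theorem_of_calculus) auto
  then show "f (x, h) = h *\<^sub>R ?g (x, h)"
    using zero[OF xh] by (auto dest!: integral_unique)
qed

text \<open>One factor \<open>h\<close> is removed at a time. Since \<open>\<delta>\<close> is
  prescribed rather than constructed, each quotient has to be identified with the remaining power of
  \<open>h\<close> times \<open>\<delta>\<close>.\<close>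

lemma smooth_quotient:
  fixes f :: "'a::finite_dim \<times> real \<Rightarrow> 'b::banach"
  assumes U: "open U"
    and star: "\<And>x h s. (x, h) \<in> U \<Longrightarrow> s \<in> {0..1} \<Longrightarrow> (x, s * h) \<in> U"
    and cont: "continuous_on U \<delta>"
  shows "smooth_on U f \<Longrightarrow> (\<And>x h. (x, h) \<in> U \<Longrightarrow> f (x, h) = h ^ k *\<^sub>R \<delta> (x, h)) \<Longrightarrow> smooth_on U \<delta>"
proof (induction k arbitrary: f)
  case 0
  then show ?case using smooth_on_cong[OF 0(1) U] by auto
next
  case (Suc k)
  have "f (x, 0) = 0" if "(x, h) \<in> U" for x h
    using Suc.prems(2)[OF star[OF that, of 0]] by simp
  then obtain g where g: "smooth_on U g" "\<And>x h. (x, h) \<in> U \<Longrightarrow> f (x, h) = h *\<^sub>R g (x, h)"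
    using ex_smooth_quotient[OF Suc.prems(1) U star] by blast
  have eq: "g (x, h) = h ^ k *\<^sub>R \<delta> (x, h)" if "(x, h) \<in> U" "h \<noteq> 0" for x h
    using g(2)[OF that(1)] Suc.prems(2)[OF that(1)] that(2) by (simp flip: scaleR_scaleR)
  \<comment> \<open>Here \<open>h\<close> cannot be cancelled. The difference \<open>?d\<close> is
    continuous and vanishes for all small nonzero \<open>h\<close>, hence also at 0.\<close>
  have "g (x, 0) = 0 ^ k *\<^sub>R \<delta> (x, 0)" if xU: "(x, 0) \<in> U" for x
  proof -
    let ?d = "\<lambda>z. g z - snd z ^ k *\<^sub>R \<delta> z"
    have "continuous_on U ?d"
      by (intro continuous_intros smooth_on_continuous g cont)
    then have "isCont ?d (x, 0)"
      using U xU continuous_on_eq_continuous_at by blast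
    then have lim: "((\<lambda>t. ?d (x, t)) \<longlongrightarrow> ?d (x, 0)) (at 0)"
      by (rule isCont_tendsto_compose) (intro tendsto_intros)
    have "\<forall>\<^sub>F t in at 0. (x, t) \<in> U"
      using U xU by (intro topological_tendstoD[of "Pair x" "(x, 0)"] tendsto_intros) auto
    then have "\<forall>\<^sub>F t in at 0. ?d (x, t) = 0"
      unfolding eventually_at_filter by eventually_elim (simp add: eq)
    then have "((\<lambda>t. ?d (x, t)) \<longlongrightarrow> 0) (at 0)"
      by (rule tendsto_eventually)
    with lim have "?d (x, 0) = 0"
      using tendsto_unique[OF trivial_limit_at] by blast
    then show ?thesis by simp
  qed
  with eq show ?case
    by (intro Suc.IH[OF g(1)]) auto
qed

section \<open>Neighbourhoods of the zero section and increments inside them\<close>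

lemma nbhd_of_zero_section_Int:
  "nbhd_of_zero_section U \<Longrightarrow> nbhd_of_zero_section V \<Longrightarrow> nbhd_of_zero_section (U \<inter> V)"
  by (auto simp: nbhd_of_zero_section_def)

text \<open>Each box has an interval centred at 0 as its second factor, so it is closed under
  shrinking \<open>h\<close>, and unions preserve this. The height of the boxes is free to depend on
  the base point.\<close>

lemma nbhd_of_zero_section_star:
  fixes U :: "('a::real_normed_vector \<times> real) set"
  assumes "nbhd_of_zero_section U"
  obtains U' where "nbhd_of_zero_section U'" "U' \<subseteq> U"
    "\<And>x h s. (x, h) \<in> U' \<Longrightarrow> s \<in> {0..1} \<Longrightarrow> (x, s * h) \<in> U'"
proof
  let ?R = "{A \<times> ball (0 :: real) e | A e. open A \<and> A \<times> ball 0 e \<subseteq> U}"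
  have "(x, 0) \<in> \<Union>?R" for x
  proof -
    have "open U" "(x, 0) \<in> U"
      using assms by (auto simp: nbhd_of_zero_section_def)
    then obtain A B where AB: "open A" "open B" "x \<in> A" "0 \<in> B" "A \<times> B \<subseteq> U"
      by (metis open_prod_elim mem_Sigma_iff)
    then obtain e where "e > 0" "ball 0 e \<subseteq> B"
      using open_contains_ball by blast
    with AB have "A \<times> ball 0 e \<subseteq> U" "(x, 0) \<in> A \<times> ball 0 e"
      by auto
    with AB have "A \<times> ball 0 e \<in> ?R" "(x, 0) \<in> A \<times> ball 0 e"
      by blast+
    then show ?thesis by blast
  qed
  then show "nbhd_of_zero_section (\<Union>?R)"
    unfolding nbhd_of_zero_section_def by (auto intro!: open_Union open_Times)
  show "\<Union>?R \<subseteq> U" by auto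
  fix x and h s :: real assume "(x, h) \<in> \<Union>?R" and s: "s \<in> {0..1}"
  then obtain Y where Y: "Y \<in> ?R" "(x, h) \<in> Y" by blast
  then obtain A e where A: "Y = A \<times> ball 0 e" by blast
  have "\<bar>s * h\<bar> \<le> \<bar>h\<bar>"
    using s by (simp add: abs_mult mult_left_le_one_le)
  with Y(2) have "(x, s * h) \<in> Y"
    by (simp add: A)
  with Y(1) show "(x, s * h) \<in> \<Union>?R" by blast
qed

text \<open>Mean value theorem in integral form: the remainder is the integral over the segment of
  the derivative of \<open>\<Phi>\<close> applied to \<open>\<Delta>\<close>. In this form its
  continuity at \<open>h = 0\<close> is visible, unlike that of a difference quotient.\<close>

lemma fibre_increment:
  fixes \<Phi> :: "'a::finite_dim \<times> real \<Rightarrow> 'b::banach"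
  assumes \<Phi>: "smooth_on V \<Phi>" "open V" and \<Delta>: "continuous_on N \<Delta>"
    and seg: "\<And>y h s. (y, h) \<in> N \<Longrightarrow> s \<in> {0..1} \<Longrightarrow> (y + (s * h ^ k) *\<^sub>R \<Delta> (y, h), h) \<in> V"
  obtains \<delta> where "continuous_on N \<delta>"
    "\<And>y h. (y, h) \<in> N \<Longrightarrow> \<Phi> (y + h ^ k *\<^sub>R \<Delta> (y, h), h) - \<Phi> (y, h) = h ^ k *\<^sub>R \<delta> (y, h)"
proof
  let ?m = "\<lambda>z s. (fst z + (s * snd z ^ k) *\<^sub>R \<Delta> z, snd z)"
  let ?F = "\<lambda>z s. blinfun_apply (blinfun_deriv \<Phi> (?m z s)) (\<Delta> z, 0)"
  let ?\<delta> = "\<lambda>z. integral (cbox 0 1) (?F z)"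
  have \<Delta>': "continuous_on (N \<times> T) (\<lambda>z. \<Delta> (fst z))" for T :: "real set"
    by (intro continuous_on_compose2[OF \<Delta>] continuous_intros) auto
  have "continuous_on (N \<times> cbox 0 1) (\<lambda>(z, s). ?F z s)"
    unfolding split_beta
    by (intro continuous_intros \<Delta>' continuous_on_compose2[OF smooth_on_continuous[OF
            smooth_on_blinfun_deriv[OF \<Phi>]]]) (use seg in auto)
  then show "continuous_on N ?\<delta>"
    by (rule integral_continuous_on_param)
  fix y h assume yh: "(y, h) \<in> N"
  let ?p = "\<lambda>s. (y + (s * h ^ k) *\<^sub>R \<Delta> (y, h), h)"
  have "((\<lambda>s. \<Phi> (?p s)) has_vector_derivative h ^ k *\<^sub>R ?F (y, h) s) (at s within {0..1})"
    if "s \<in> {0..1}" for s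
  proof -
    have "((\<lambda>s. \<Phi> (?p s)) has_derivative
        (\<lambda>t. blinfun_apply (blinfun_deriv \<Phi> (?p s)) ((t * h ^ k) *\<^sub>R \<Delta> (y, h), 0))) (at s within {0..1})"
      using smooth_on_has_blinfun_deriv[OF \<Phi>(1) seg[OF yh that]]
      by (intro has_derivative_compose[of ?p "\<lambda>t. ((t * h ^ k) *\<^sub>R \<Delta> (y, h), 0)" s "{0..1}" \<Phi>])
        (auto intro!: derivative_eq_intros)
    moreover have "blinfun_apply l ((t * h ^ k) *\<^sub>R v, 0) = t *\<^sub>R h ^ k *\<^sub>R blinfun_apply l (v, 0)"
      for t v and l :: "('a \<times> real) \<Rightarrow>\<^sub>L 'b"
      using blinfun.scaleR_right[of l "t * h ^ k" "(v, 0)"] by simp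
    ultimately show ?thesis by (simp add: has_vector_derivative_def)
  qed
  then have "((\<lambda>s. h ^ k *\<^sub>R ?F (y, h) s) has_integral \<Phi> (?p 1) - \<Phi> (?p 0)) {0..1}"
    by (intro fundamental_theorem_of_calculus) auto
  then show "\<Phi> (y + h ^ k *\<^sub>R \<Delta> (y, h), h) - \<Phi> (y, h) = h ^ k *\<^sub>R ?\<delta> (y, h)"
    by (auto dest!: integral_unique)
qed


subsection \<open>Uniqueness of solutions of differential equations\<close>

lemma smooth_on_lipschitz_cball:
  fixes f :: "'a::finite_dim \<Rightarrow> 'b::real_normed_vector"
  assumes "smooth_on UNIV f"
  obtains L where "L \<ge> 0" "\<And>x y. x \<in> cball 0 R \<Longrightarrow> y \<in> cball 0 R \<Longrightarrow> norm (f x - f y) \<le> L * norm (x - y)"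
proof -
  have "compact ((\<lambda>x. norm (blinfun_deriv f x)) ` cball 0 R)"
    by (intro compact_continuous_image continuous_intros continuous_on_subset[OF
          smooth_on_continuous[OF smooth_on_blinfun_deriv[OF assms]]])
      (auto simp: compact_eq_bounded_closed)
  then have "bounded ((\<lambda>x. norm (blinfun_deriv f x)) ` cball 0 R)"
    by (rule compact_imp_bounded)
  then obtain L where L: "\<forall>x\<in>cball 0 R. norm (blinfun_deriv f x) \<le> L"
    unfolding bounded_iff by auto
  \<comment> \<open>For \<open>R < 0\<close> the ball is empty and the bound obtained from
    compactness may be negative.\<close>
  have "norm (f x - f y) \<le> max L 0 * norm (x - y)" if "x \<in> cball 0 R" "y \<in> cball 0 R" for x y
    using that
  proof (intro differentiable_bound[of "cball 0 R"])
    show "(f has_derivative blinfun_apply (blinfun_deriv f x)) (at x within cball 0 R)" for x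
      using smooth_on_has_blinfun_deriv[OF assms] by (auto intro: has_derivative_at_withinI)
    show "onorm (blinfun_apply (blinfun_deriv f x)) \<le> max L 0" if "x \<in> cball 0 R" for x
      using bspec[OF L that] by (simp add: norm_blinfun.rep_eq)
  qed auto
  with that show ?thesis by (meson max.cobounded2)
qed

text \<open>The maximum of the distance of the two solutions, weighted with \<open>exp (- 2 c s)\<close> for \<open>c\<close> above
  the Lipschitz constant, is at most half of itself.\<close>

lemma ode_unique:
  fixes f :: "'a::finite_dim \<Rightarrow> 'a"
  assumes f: "smooth_on UNIV f"
    and z1: "\<And>s. s \<in> {0..1} \<Longrightarrow> (z1 has_vector_derivative h *\<^sub>R f (z1 s)) (at s within {0..1})"
    and z2: "\<And>s. s \<in> {0..1} \<Longrightarrow> (z2 has_vector_derivative h *\<^sub>R f (z2 s)) (at s within {0..1})"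
    and init: "z1 0 = z2 0" and s: "s \<in> {0..1}"
  shows "z1 s = z2 s"
proof -
  have cont: "continuous_on {0..1} z1" "continuous_on {0..1} z2"
    by (rule continuous_on_vector_derivative[OF z1]) (simp, rule continuous_on_vector_derivative[OF z2], simp)
  have "bounded (z1 ` {0..1} \<union> z2 ` {0..1})"
    using cont by (intro compact_imp_bounded compact_Un compact_continuous_image) auto
  then obtain R where "\<forall>x\<in>z1 ` {0..1} \<union> z2 ` {0..1}. norm x \<le> R"
    unfolding bounded_iff by blast
  then have R: "z1 s \<in> cball 0 R \<and> z2 s \<in> cball 0 R" if "s \<in> {0..1}" for s
    using that by simp
  obtain L where L: "L \<ge> 0"
    "\<And>x y. x \<in> cball 0 R \<Longrightarrow> y \<in> cball 0 R \<Longrightarrow> norm (f x - f y) \<le> L * norm (x - y)"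
    using smooth_on_lipschitz_cball[OF f, of R] by blast
  define c where "c = \<bar>h\<bar> * L + 1"
  have c: "c > 0" using L(1) by (simp add: c_def add_nonneg_pos)
  let ?w = "\<lambda>s. z1 s - z2 s"
  let ?m = "\<lambda>s. norm (?w s) * exp (- 2 * c * s)"
  have "continuous_on {0..1} ?m"
    by (intro continuous_intros cont)
  then obtain m where m: "m \<in> {0..1}" "\<And>s. s \<in> {0..1} \<Longrightarrow> ?m s \<le> ?m m"
    using continuous_attains_sup[of "{0..1}" ?m] by auto
  define M where "M = ?m m"
  have w: "norm (?w s) \<le> M * exp (2 * c * s)" if "s \<in> {0..1}" for s
  proof -
    have "norm (?w s) = ?m s * exp (2 * c * s)"
      by (simp add: mult_exp_exp mult.assoc)
    also have "\<dots> \<le> M * exp (2 * c * s)"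
      using m(2)[OF that] by (auto simp: M_def)
    finally show ?thesis .
  qed
  have "M \<le> 0"
  proof (cases "m = 0")
    case True
    then show ?thesis by (simp add: M_def init)
  next
    case False
    \<comment> \<open>The comparison function grows with derivative
      \<open>c * (M * exp (2 * c * s))\<close>; integrating the exponent \<open>2 * c\<close> is
      what produces the factor one half.\<close>
    have "norm (?w m - ?w 0) \<le> M / 2 * exp (2 * c * m) - M / 2 * exp (2 * c * 0)"
    proof (rule differentiable_bound_general[where f' = "\<lambda>s. h *\<^sub>R f (z1 s) - h *\<^sub>R f (z2 s)" and
          \<phi>' = "\<lambda>s. c * (M * exp (2 * c * s))"])
      show "0 < m" using m False by auto
      show "continuous_on {0..m} ?w"
        using cont m by (intro continuous_intros; elim continuous_on_subset) auto
      show "continuous_on {0..m} (\<lambda>s. M / 2 * exp (2 * c * s))"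
        by (intro continuous_intros)
      fix s assume s: "0 < s" "s < m"
      then have s1: "s \<in> {0..1}" "s \<in> interior {0..1}" using m by auto
      show "(?w has_vector_derivative h *\<^sub>R f (z1 s) - h *\<^sub>R f (z2 s)) (at s)"
        using z1[OF s1(1)] z2[OF s1(1)] unfolding at_within_interior[OF s1(2)]
        by (intro has_vector_derivative_diff)
      show "((\<lambda>s. M / 2 * exp (2 * c * s)) has_vector_derivative c * (M * exp (2 * c * s))) (at s)"
        unfolding has_real_derivative_iff_has_vector_derivative[symmetric]
        by (auto intro!: derivative_eq_intros)
      have "norm (h *\<^sub>R f (z1 s) - h *\<^sub>R f (z2 s)) = \<bar>h\<bar> * norm (f (z1 s) - f (z2 s))"
        by (simp add: scaleR_right_diff_distrib[symmetric])
      also have "\<dots> \<le> \<bar>h\<bar> * (L * norm (?w s))"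
        using L(2) R[OF s1(1)] by (intro mult_left_mono) auto
      also have "\<dots> \<le> c * norm (?w s)"
        by (simp add: c_def algebra_simps)
      also have "\<dots> \<le> c * (M * exp (2 * c * s))"
        using w[OF s1(1)] c by (intro mult_left_mono) auto
      finally show "norm (h *\<^sub>R f (z1 s) - h *\<^sub>R f (z2 s)) \<le> c * (M * exp (2 * c * s))" .
    qed
    moreover have "M \<ge> 0" by (simp add: M_def)
    ultimately have "norm (?w m) \<le> M / 2 * exp (2 * c * m)"
      by (simp add: init)
    then have "norm (?w m) * exp (- 2 * c * m) \<le> M / 2 * exp (2 * c * m) * exp (- 2 * c * m)"
      by (intro mult_right_mono) auto
    also have "\<dots> = M / 2"
      by (simp add: mult_exp_exp mult.assoc)
    finally show ?thesis by (simp add: M_def)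
  qed
  then have "M * exp (2 * c * s) \<le> 0"
    by (simp add: mult_nonpos_nonneg)
  with w[OF s] have "norm (?w s) \<le> 0" by linarith
  then show ?thesis by simp
qed


subsection \<open>Inverse mapping theorem near the zero section\<close>

text \<open>A solution of \<open>A v = w\<close> is a fixed point of v \<mapsto> w - (A v - v), a
  contraction with constant 1/2. The same estimate gives \<open>norm v \<le> 2 * norm (A v)\<close>,
  hence injectivity and the bound 2 for the inverse.\<close>

lemma blinfun_inverse_near_id:
  fixes A :: "'a::banach \<Rightarrow>\<^sub>L 'a"
  assumes A: "norm (A - id_blinfun) \<le> 1 / 2"
  obtains N where "N o\<^sub>L A = id_blinfun" "A o\<^sub>L N = id_blinfun" "norm N \<le> 2"
proof -
  have est: "norm (blinfun_apply A v - v) \<le> norm v / 2" for v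
  proof -
    have "norm (blinfun_apply (A - id_blinfun) v) \<le> norm (A - id_blinfun) * norm v"
      by (rule norm_blinfun)
    also have "\<dots> \<le> 1 / 2 * norm v"
      by (rule mult_right_mono[OF A]) simp
    finally show ?thesis by (simp add: blinfun.diff_left)
  qed
  have bound: "norm v \<le> 2 * norm (blinfun_apply A v)" for v
    using est[of v] norm_triangle_ineq2[of v "blinfun_apply A v"] by (simp add: norm_minus_commute)
  have "\<exists>v. blinfun_apply A v = w" for w
  proof -
    let ?T = "\<lambda>v. w - (blinfun_apply A v - v)"
    have "dist (?T v) (?T u) \<le> 1 / 2 * dist v u" for u v
      using est[of "v - u"] by (simp add: dist_norm blinfun.diff_right norm_minus_commute algebra_simps)
    then have "\<exists>!v. ?T v = v"
      by (intro banach_fix_type[of "1 / 2"]) auto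
    then show ?thesis by (auto simp: algebra_simps)
  qed
  then obtain N where N: "\<And>w. blinfun_apply A (N w) = w" by metis
  have inj: "u = v" if "blinfun_apply A u = blinfun_apply A v" for u v
    using bound[of "u - v"] that by (simp add: blinfun.diff_right)
  have "bounded_linear N"
  proof (rule bounded_linear_intro)
    show "N (x + y) = N x + N y" for x y
      by (rule inj) (simp add: N blinfun.add_right)
    show "N (r *\<^sub>R x) = r *\<^sub>R N x" for r x
      by (rule inj) (simp add: N blinfun.scaleR_right)
    show "norm (N x) \<le> norm x * 2" for x
      using bound[of "N x"] by (simp add: N)
  qed
  then have N': "blinfun_apply (Blinfun N) = N"
    by (rule bounded_linear_Blinfun_apply)
  show ?thesis
  proof
    show "Blinfun N o\<^sub>L A = id_blinfun"
      by (rule blinfun_eqI, rule inj) (simp add: N N')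
    show "A o\<^sub>L Blinfun N = id_blinfun"
      by (rule blinfun_eqI) (simp add: N N')
    show "norm (Blinfun N) \<le> 2"
      using bound[of "N w" for w] by (intro norm_blinfun_bound) (auto simp: N N')
  qed
qed

text \<open>Everything rests on the identity
  \<open>N z - N z0 = N z o\<^sub>L (A z0 - A z) o\<^sub>L N z0\<close>. Together with the uniform
  bound \<open>K\<close> it yields the continuity of \<open>N\<close>, which in turn makes the
  linearisation error of \<open>N\<close> negligible.\<close>

lemma has_derivative_blinfun_inverse:
  fixes A :: "'c::real_normed_vector \<Rightarrow> 'a::real_normed_vector \<Rightarrow>\<^sub>L 'a"
  assumes S: "open S" "z0 \<in> S" and D: "(A has_derivative A') (at z0)"
    and N: "\<And>z. z \<in> S \<Longrightarrow> N z o\<^sub>L A z = id_blinfun" "\<And>z. z \<in> S \<Longrightarrow> A z o\<^sub>L N z = id_blinfun"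
      "\<And>z. z \<in> S \<Longrightarrow> norm (N z) \<le> K"
  shows "(N has_derivative (\<lambda>u. - (N z0 o\<^sub>L A' u o\<^sub>L N z0))) (at z0)"
proof -
  have lin: "bounded_linear A'" and lim: "((\<lambda>z. norm (A z - A z0 - A' (z - z0)) / norm (z - z0)) \<longlongrightarrow> 0) (at z0)"
    using D unfolding has_derivative_iff_norm by auto
  have K: "K \<ge> 0" using N(3)[OF S(2)] norm_ge_zero order_trans by blast
  have NA: "blinfun_apply (N z) (blinfun_apply (A z) w) = w"
    "blinfun_apply (A z) (blinfun_apply (N z) w) = w" if "z \<in> S" for z w
    using N(1,2)[OF that] by (metis blinfun_apply_blinfun_compose blinfun_apply_id_blinfun)+
  have diff: "N z - N z0 = N z o\<^sub>L (A z0 - A z) o\<^sub>L N z0" if "z \<in> S" for z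
    by (rule blinfun_eqI) (simp add: blinfun.diff_left blinfun.diff_right NA that S(2))
  have near: "\<forall>\<^sub>F z in at z0. z \<in> S"
    using S by (rule eventually_at_in_open')
  have A_lim: "(A \<longlongrightarrow> A z0) (at z0)"
    using has_derivative_continuous[OF D] by (simp add: continuous_at)
  have compose3: "norm (f o\<^sub>L g o\<^sub>L h) \<le> norm f * norm g * norm h" for f g h :: "'a \<Rightarrow>\<^sub>L 'a"
    using norm_blinfun_compose[of "f o\<^sub>L g" h] mult_right_mono[OF norm_blinfun_compose[of f g], of "norm h"]
    by simp
  have "((\<lambda>z. N z - N z0) \<longlongrightarrow> 0) (at z0)"
  proof (rule Lim_null_comparison)
    show "\<forall>\<^sub>F z in at z0. norm (N z - N z0) \<le> K * norm (A z0 - A z) * K"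
      using near
    proof eventually_elim
      case (elim z)
      have "norm (N z - N z0) \<le> norm (N z) * norm (A z0 - A z) * norm (N z0)"
        unfolding diff[OF elim] by (rule compose3)
      also have "\<dots> \<le> K * norm (A z0 - A z) * K"
        using N(3) S elim K by (intro mult_mono) auto
      finally show ?case .
    qed
    show "((\<lambda>z. K * norm (A z0 - A z) * K) \<longlongrightarrow> 0) (at z0)"
      using tendsto_mult_left_zero[OF tendsto_mult_right_zero[OF tendsto_norm_zero[OF LIM_zero[OF A_lim]]]]
      by (simp add: norm_minus_commute)
  qed
  then have N_lim: "((\<lambda>z. norm (N z - N z0)) \<longlongrightarrow> 0) (at z0)"
    by (rule tendsto_norm_zero)
  obtain C where C: "\<And>u. norm (A' u) \<le> C * norm u" "C \<ge> 0"
    using bounded_linear.nonneg_bounded[OF lin] by (metis mult.commute)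
  show ?thesis
    unfolding has_derivative_iff_norm
  proof (intro conjI)
    show "bounded_linear (\<lambda>u. - (N z0 o\<^sub>L A' u o\<^sub>L N z0))"
      by (intro bounded_linear_minus bounded_linear_compose[OF bounded_bilinear.bounded_linear_left[OF
            bounded_bilinear_blinfun_compose]] bounded_linear_compose[OF bounded_bilinear.bounded_linear_right[OF
            bounded_bilinear_blinfun_compose]] lin)
    let ?R = "\<lambda>z. norm (A z - A z0 - A' (z - z0)) / norm (z - z0)"
    show "((\<lambda>z. norm (N z - N z0 - - (N z0 o\<^sub>L A' (z - z0) o\<^sub>L N z0)) / norm (z - z0)) \<longlongrightarrow> 0) (at z0)"
    proof (rule Lim_null_comparison)
      show "\<forall>\<^sub>F z in at z0. norm (norm (N z - N z0 - - (N z0 o\<^sub>L A' (z - z0) o\<^sub>L N z0)) / norm (z - z0))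
          \<le> K * ?R z * K + norm (N z - N z0) * C * K"
        using near eventually_neq_at_within[of z0]
      proof eventually_elim
        case (elim z)
        let ?u = "z - z0"
        \<comment> \<open>The first summand carries the linearisation error of \<open>A\<close>, the
          second the oscillation of \<open>N\<close>; both are small compared with
          \<open>norm ?u\<close>.\<close>
        have "N z - N z0 - - (N z0 o\<^sub>L A' ?u o\<^sub>L N z0) =
            - (N z o\<^sub>L (A z - A z0 - A' ?u) o\<^sub>L N z0) + (- ((N z - N z0) o\<^sub>L A' ?u o\<^sub>L N z0))"
          by (rule blinfun_eqI) (simp add: blinfun.bilinear_simps NA elim S(2))
        also have "norm \<dots> \<le> norm (N z o\<^sub>L (A z - A z0 - A' ?u) o\<^sub>L N z0) +
            norm ((N z - N z0) o\<^sub>L A' ?u o\<^sub>L N z0)"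
          by (rule norm_triangle_le) simp
        also have "\<dots> \<le> norm (N z) * norm (A z - A z0 - A' ?u) * norm (N z0) +
            norm (N z - N z0) * norm (A' ?u) * norm (N z0)"
          by (intro add_mono compose3)
        also have "\<dots> \<le> K * norm (A z - A z0 - A' ?u) * K + norm (N z - N z0) * (C * norm ?u) * K"
          using N(3) S elim K C by (intro add_mono mult_mono) auto
        finally show ?case
          using elim(2) by (simp add: field_simps)
      qed
      show "((\<lambda>z. K * ?R z * K + norm (N z - N z0) * C * K) \<longlongrightarrow> 0) (at z0)"
        using tendsto_add[OF tendsto_mult_left_zero[OF tendsto_mult_right_zero[OF lim]]
            tendsto_mult_left_zero[OF tendsto_mult_left_zero[OF N_lim]]] by simp
    qed
  qed
qed

text \<open>Bootstrapping: the derivative of \<open>N\<close> is a product of \<open>N\<close>, the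
  derivative of \<open>A\<close> and \<open>N\<close>, up to sign, so each order of
  differentiability of \<open>N\<close> yields the next.\<close>

lemma smooth_on_blinfun_inverse:
  fixes A :: "'c::real_normed_vector \<Rightarrow> 'a::real_normed_vector \<Rightarrow>\<^sub>L 'a"
  assumes A: "smooth_on S A" "open S"
    and N: "\<And>z. z \<in> S \<Longrightarrow> N z o\<^sub>L A z = id_blinfun" "\<And>z. z \<in> S \<Longrightarrow> A z o\<^sub>L N z = id_blinfun"
      "\<And>z. z \<in> S \<Longrightarrow> norm (N z) \<le> K"
  shows "smooth_on S N"
proof -
  have D: "(N has_derivative (\<lambda>u. - (N z o\<^sub>L frechet_derivative A (at z) u o\<^sub>L N z))) (at z)" if "z \<in> S" for z
    by (rule has_derivative_blinfun_inverse[OF A(2) that smooth_on_has_derivative[OF A(1) that] N])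
  have "Ck_on n S N" for n
  proof (induction n)
    case 0
    then show ?case
      by (auto intro!: continuous_at_imp_continuous_on has_derivative_continuous[OF D])
  next
    case (Suc n)
    have "Ck_on n S (\<lambda>z. frechet_derivative A (at z) u)" for u
      using smooth_on_derivative[OF A(1)] by (simp add: smooth_on_def)
    then show ?case
      using Suc A(2) D
      by (intro Ck_on_SucI[OF A(2) D] Ck_on_linear[OF bounded_linear_minus[OF bounded_linear_ident]]
          Ck_on_bilinear[OF bounded_bilinear_blinfun_compose]) auto
  qed
  then show ?thesis by (simp add: smooth_on_def)
qed

text \<open>Bootstrapping again: the derivative of \<open>g\<close> at \<open>y\<close> is
  \<open>B (g y)\<close>, so it is as often differentiable as \<open>g\<close> itself.
  \<open>B\<close> is a family of maps, smooth for each fixed vector, so that it can be supplied by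
  a formula.\<close>

lemma smooth_on_inverse:
  fixes g :: "'b::finite_dim \<Rightarrow> 'a::finite_dim"
  assumes U: "open U" and V: "open V" "g ` V \<subseteq> U" "continuous_on V g" "\<And>y. y \<in> V \<Longrightarrow> f (g y) = y"
    and D: "\<And>z. z \<in> U \<Longrightarrow> (f has_derivative f' z) (at z)"
    and B: "\<And>z. z \<in> U \<Longrightarrow> bounded_linear (B z)" "\<And>z v. z \<in> U \<Longrightarrow> B z (f' z v) = v"
      "\<And>w. smooth_on U (\<lambda>z. B z w)"
  shows "smooth_on V g"
proof -
  have D: "(g has_derivative B (g y)) (at y)" if y: "y \<in> V" for y
  proof (rule has_derivative_inverse_basic[OF D B(1) _ _ V(1) y V(4)])
    show "isCont g y" using V y by (simp add: continuous_on_eq_continuous_at)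
  qed (use V y B(2) in \<open>auto simp: fun_eq_iff\<close>)
  have "Ck_on n V g" for n
  proof (induction n)
    case 0
    then show ?case using V by simp
  next
    case (Suc n)
    have c: "Ck_on n V (\<lambda>y. B (g y) w)" for w
      using B(3)[of w] by (intro Ck_on_compose[OF V(1) U V(2) Suc]) (simp add: smooth_on_def)
    show ?case by (rule Ck_on_SucI[OF V(1) D c])
  qed
  then show ?thesis by (simp add: smooth_on_def)
qed

text \<open>The derivative with \<open>h\<close> held fixed, extracted from the joint derivative so
  that it inherits smoothness in \<open>(x, h)\<close>.\<close>

definition fibre_deriv :: "('a::real_normed_vector \<times> real \<Rightarrow> 'b::real_normed_vector) \<Rightarrow> 'a \<times> real \<Rightarrow> 'a \<Rightarrow>\<^sub>L 'b"
  where "fibre_deriv f z = blinfun_deriv f z o\<^sub>L Blinfun (\<lambda>v. (v, 0))"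

lemma fibre_deriv_apply:
  fixes f :: "'a::real_normed_vector \<times> real \<Rightarrow> 'b::real_normed_vector"
  shows "blinfun_apply (fibre_deriv f z) v = blinfun_apply (blinfun_deriv f z) (v, 0)"
proof -
  have "bounded_linear (\<lambda>v :: 'a. (v, 0 :: real))"
    by (intro bounded_linear_Pair bounded_linear_zero bounded_linear_ident)
  then show ?thesis by (simp add: fibre_deriv_def bounded_linear_Blinfun_apply)
qed

lemma has_derivative_fibre:
  assumes "smooth_on W f" "(x, h) \<in> W"
  shows "((\<lambda>x. f (x, h)) has_derivative blinfun_apply (fibre_deriv f (x, h))) (at x)"
proof -
  have "((\<lambda>x. f (x, h)) has_derivative (\<lambda>v. blinfun_apply (blinfun_deriv f (x, h)) (v, 0))) (at x)"
    using smooth_on_has_blinfun_deriv[OF assms]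
    by (intro has_derivative_compose[of "\<lambda>x. (x, h)" _ x UNIV f]) (auto intro!: derivative_eq_intros)
  then show ?thesis by (simp add: fibre_deriv_apply[symmetric])
qed

lemma smooth_on_fibre_deriv:
  fixes f :: "'a::finite_dim \<times> real \<Rightarrow> 'b::real_normed_vector"
  assumes "open W" "smooth_on W f"
  shows "smooth_on W (fibre_deriv f)"
  unfolding fibre_deriv_def[abs_def]
  by (intro smooth_on_bilinear[OF bounded_bilinear_blinfun_compose] smooth_on_blinfun_deriv
      smooth_on_const assms)

text \<open>On a ball around \<open>0\<close> every fibre map is a small perturbation of the identity, for \<open>h\<close> small
  depending on the ball. Two points over the same \<open>h\<close> lie in the larger of their two boxes, which
  makes the fibre maps injective on the union of all boxes.\<close>

lemma fibre_diffeo: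
  fixes l :: "'a::finite_dim \<times> real \<Rightarrow> 'a"
  assumes W: "nbhd_of_zero_section W" and l: "smooth_on W l" and l0: "\<And>x. l (x, 0) = x"
  obtains U V where "U \<subseteq> W" "nbhd_of_zero_section U" "nbhd_of_zero_section V"
    "diffeo_between (\<lambda>(x, h). (l (x, h), h)) U V"
proof -
  have oW: "open W" and W0: "\<And>x. (x, 0) \<in> W"
    using W by (auto simp: nbhd_of_zero_section_def)
  define A where "A = fibre_deriv l"
  have A: "smooth_on W A"
    unfolding A_def by (rule smooth_on_fibre_deriv[OF oW l])
  have DA: "((\<lambda>x. l (x, h)) has_derivative blinfun_apply (A (x, h))) (at x)" if "(x, h) \<in> W" for x h
    unfolding A_def by (rule has_derivative_fibre[OF l that])
  have A0: "A (x, 0) = id_blinfun" for x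
  proof -
    have "((\<lambda>x. x) has_derivative blinfun_apply (A (x, 0))) (at x)"
      using DA[OF W0, of x] by (simp add: l0)
    then have "blinfun_apply (A (x, 0)) = (\<lambda>v. v)"
      by (rule has_derivative_unique[OF _ has_derivative_ident])
    then show ?thesis
      by (intro blinfun_eqI) simp
  qed
  \<comment> \<open>The threshold 1/2 serves twice: the fibre derivative is invertible with inverse
    bounded by 2, and \<open>l (x, h) - x\<close> has Lipschitz constant 1/2 on convex slices of
    \<open>Y\<close>.\<close>
  define Y where "Y = {z \<in> W. norm (A z - id_blinfun) < 1 / 2}"
  have oY: "open Y"
  proof -
    have "open (W \<inter> (\<lambda>z. norm (A z - id_blinfun)) -` {..<1 / 2})"
      by (intro continuous_open_preimage continuous_intros smooth_on_continuous A oW)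
    then show ?thesis by (simp add: Y_def vimage_def Int_def)
  qed
  have Y0: "(x, 0) \<in> Y" for x by (simp add: Y_def W0 A0)
  define U :: "('a \<times> real) set"
    where "U = (\<Union>(r, e)\<in>{(r, e). ball 0 r \<times> ball 0 e \<subseteq> Y}. ball 0 r \<times> ball 0 e)"
  have U_boxE: thesis
    if "(x, h) \<in> U" "\<And>r e. ball 0 r \<times> ball 0 e \<subseteq> Y \<Longrightarrow> x \<in> ball 0 r \<Longrightarrow> h \<in> ball 0 e \<Longrightarrow> thesis"
    for x h thesis
    using that unfolding U_def by blast
  have U_Y: "U \<subseteq> Y" and oU: "open U"
    unfolding U_def by (auto intro!: open_UN open_Times)
  have U_W: "U \<subseteq> W" using U_Y by (auto simp: Y_def)
  have U0: "(x, 0) \<in> U" for x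
  proof -
    \<comment> \<open>Tube lemma: compactness gives one height \<open>e\<close> for the whole
      ball.\<close>
    let ?C = "cball (0 :: 'a) (norm x + 1) \<times> {0 :: real}"
    have "compact ?C" by (intro compact_Times) (auto simp: compact_eq_bounded_closed)
    then obtain e where e: "e > 0" "(\<Union>z\<in>?C. ball z e) \<subseteq> Y"
      by (rule compact_subset_open_imp_ball_epsilon_subset[OF _ oY]) (use Y0 in auto)
    have "ball 0 (norm x + 1) \<times> ball 0 e \<subseteq> Y"
    proof clarify
      fix y :: 'a and h :: real assume "y \<in> ball 0 (norm x + 1)" "h \<in> ball 0 e"
      then have yh: "(y, 0) \<in> ?C" "(y, h) \<in> ball (y, 0) e"
        by (auto simp: dist_prod_def)
      show "(y, h) \<in> Y"
        using yh by (intro subsetD[OF e(2)] UN_I[of "(y, 0)"])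
    qed
    moreover have "(x, 0) \<in> ball 0 (norm x + 1) \<times> ball 0 e" using e by simp
    ultimately show ?thesis unfolding U_def by (intro UN_I[of "(norm x + 1, e)"]) auto
  qed
  have contr: "norm ((l (x, h) - x) - (l (y, h) - y)) \<le> 1 / 2 * norm (x - y)"
    if C: "convex C" "\<And>x. x \<in> C \<Longrightarrow> (x, h) \<in> Y" and xy: "x \<in> C" "y \<in> C" for C x y h
  proof (rule differentiable_bound[OF C(1) _ _ xy])
    fix x assume "x \<in> C"
    then have x: "(x, h) \<in> W" "norm (A (x, h) - id_blinfun) \<le> 1 / 2"
      using C(2)[of x] by (auto simp: Y_def)
    have "blinfun_apply (A (x, h) - id_blinfun) = (\<lambda>v. blinfun_apply (A (x, h)) v - v)"
      by (simp add: fun_eq_iff blinfun.diff_left)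
    then show "((\<lambda>x. l (x, h) - x) has_derivative blinfun_apply (A (x, h) - id_blinfun)) (at x within C)"
      by (simp only:) (intro has_derivative_diff has_derivative_at_withinI[OF DA[OF x(1)]] has_derivative_ident)
    show "onorm (blinfun_apply (A (x, h) - id_blinfun)) \<le> 1 / 2"
      using x(2) by (simp add: norm_blinfun.rep_eq)
  qed
  let ?L = "\<lambda>(x, h). (l (x, h), h)"
  have inj: "inj_on ?L U"
  proof (rule inj_onI)
    fix z z' assume z: "z \<in> U" "z' \<in> U" "?L z = ?L z'"
    then obtain x y h where zz: "z = (x, h)" "z' = (y, h)"
      by (metis (no_types, lifting) case_prod_conv prod.collapse prod.inject)
    with z have xU: "(x, h) \<in> U" and yU: "(y, h) \<in> U" and eq: "l (x, h) = l (y, h)"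
      by simp_all
    obtain r e where r: "ball 0 r \<times> ball 0 e \<subseteq> Y" "x \<in> ball 0 r" "h \<in> ball 0 e"
      using U_boxE[OF xU] .
    obtain r' e' where r': "ball 0 r' \<times> ball 0 e' \<subseteq> Y" "y \<in> ball 0 r'" "h \<in> ball 0 e'"
      using U_boxE[OF yU] .
    have "ball 0 (max r r') \<times> {h} \<subseteq> Y"
    proof (cases "r \<le> r'")
      case True
      then show ?thesis using r' by (auto simp: max_def)
    next
      case False
      then show ?thesis using r by (auto simp: max_def)
    qed
    moreover have "x \<in> ball 0 (max r r')" "y \<in> ball 0 (max r r')"
      using r(2) r'(2) by auto
    ultimately obtain R where "ball 0 R \<times> {h} \<subseteq> Y" "x \<in> ball 0 R" "y \<in> ball 0 R"
      by blast
    then have "norm ((l (x, h) - x) - (l (y, h) - y)) \<le> 1 / 2 * norm (x - y)"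
      by (intro contr[of "ball 0 R"]) auto
    then have "norm (x - y) \<le> 1 / 2 * norm (x - y)"
      using eq by (simp add: norm_minus_commute)
    then show "z = z'" by (simp add: zz)
  qed
  \<comment> \<open>Openness for all open subsets of \<open>U\<close> yields both the openness of
    the image \<open>V\<close> and the continuity of the inverse.\<close>
  have open_map: "open (?L ` U')" if U': "open U'" "U' \<subseteq> U" for U'
  proof (subst open_subopen, rule ballI)
    fix p assume "p \<in> ?L ` U'"
    then obtain x0 h0 where p: "p = ?L (x0, h0)" and xh: "(x0, h0) \<in> U'" by auto
    obtain X T where XT: "open X" "open T" "x0 \<in> X" "h0 \<in> T" "X \<times> T \<subseteq> U'"
      by (rule open_prod_elim[OF U'(1) xh]) auto
    then obtain \<rho> where \<rho>: "\<rho> > 0" "cball x0 \<rho> \<subseteq> X"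
      using open_contains_cball by blast
    have sub: "(x, h) \<in> U'" if "x \<in> cball x0 \<rho>" "h \<in> T" for x h
      using that \<rho> XT(5) by blast
    \<comment> \<open>For \<open>y\<close> in this tube, \<open>?T\<close> moves the centre
      \<open>x0\<close> by less than \<open>\<rho> / 2\<close>, and its contraction constant 1/2
      adds at most another \<open>\<rho> / 2\<close>. So \<open>?T\<close> maps the closed ball of
      radius \<open>\<rho>\<close> into itself, and its fixed point is a preimage of
      \<open>y\<close>.\<close>
    let ?P = "(UNIV \<times> T) \<inter> (\<lambda>(y, h). norm (y - l (x0, h))) -` {..<\<rho> / 2}"
    have "continuous_on (UNIV \<times> T) (\<lambda>(y, h). norm (y - l (x0, h)))"
    proof -
      have "(x0, h) \<in> W" if "h \<in> T" for h
        using sub[of x0 h] \<rho>(1) U'(2) U_W that by auto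
      then show ?thesis
        unfolding split_beta
        by (intro continuous_intros continuous_on_compose2[OF smooth_on_continuous[OF l]]) auto
    qed
    then have "open ?P"
      using XT(2) by (intro continuous_open_preimage open_Times) auto
    moreover have "(l (x0, h0), h0) \<in> ?P" using XT \<rho> by simp
    moreover have "?P \<subseteq> ?L ` U'"
    proof (rule subsetI)
      fix w assume "w \<in> ?P"
      then obtain y h where w: "w = (y, h)" and h: "h \<in> T" and y: "norm (y - l (x0, h)) < \<rho> / 2"
        by auto
      let ?T = "\<lambda>x. y - (l (x, h) - x)"
      have c: "dist (?T x) (?T x') \<le> 1 / 2 * dist x x'" if "x \<in> cball x0 \<rho>" "x' \<in> cball x0 \<rho>" for x x'
      proof -
        have "(x, h) \<in> Y" if "x \<in> cball x0 \<rho>" for x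
          using sub[OF that h] U'(2) U_Y by blast
        then have "norm ((l (x', h) - x') - (l (x, h) - x)) \<le> 1 / 2 * norm (x' - x)"
          using that by (intro contr[of "cball x0 \<rho>"]) auto
        moreover have "dist (?T x) (?T x') = norm ((l (x', h) - x') - (l (x, h) - x))"
          by (simp add: dist_norm algebra_simps)
        ultimately show ?thesis
          by (simp add: dist_norm norm_minus_commute)
      qed
      have "\<exists>!x\<in>cball x0 \<rho>. ?T x = x"
      proof (rule Banach_fix[OF _ _ _ _ _ c])
        show "?T ` cball x0 \<rho> \<subseteq> cball x0 \<rho>"
        proof clarify
          fix x assume x: "x \<in> cball x0 \<rho>"
          have "dist x0 (?T x) \<le> dist x0 (?T x0) + dist (?T x0) (?T x)"
            by (rule dist_triangle)
          also have "\<dots> \<le> \<rho> / 2 + 1 / 2 * dist x0 x"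
            using c[of x0 x] x y \<rho> by (intro add_mono) (auto simp: dist_norm norm_minus_commute)
          also have "\<dots> \<le> \<rho>" using x by simp
          finally show "?T x \<in> cball x0 \<rho>" by simp
        qed
      qed (use \<rho> in \<open>auto intro: compact_imp_complete simp: compact_eq_bounded_closed\<close>)
      then obtain x where x: "x \<in> cball x0 \<rho>" "?T x = x" by blast
      then have "(y, h) = ?L (x, h)" by (simp add: algebra_simps)
      then show "w \<in> ?L ` U'" unfolding w using sub[OF x(1) h] by blast
    qed
    ultimately show "\<exists>P. open P \<and> p \<in> P \<and> P \<subseteq> ?L ` U'"
      unfolding p by auto
  qed
  define V where "V = ?L ` U"
  let ?g = "inv_into U ?L"
  have oV: "open V" unfolding V_def by (rule open_map[OF oU]) simp
  have V0: "(x, 0) \<in> V" for x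
    unfolding V_def by (rule image_eqI[OF _ U0[of x]]) (simp add: l0)
  have L: "smooth_on U ?L"
    unfolding split_beta prod.collapse
    by (intro smooth_on_Pair smooth_on_snd smooth_on_ident smooth_on_subset[OF l U_W] oU)
  have gV: "?g ` V \<subseteq> U" "\<And>y. y \<in> V \<Longrightarrow> ?L (?g y) = y"
    unfolding V_def by (intro image_subsetI inv_into_into; assumption) (rule f_inv_into_f)
  have cont_g: "continuous_on V ?g"
  proof (rule continuous_on_inverse_open_map)
    show "continuous_on U ?L" by (rule smooth_on_continuous[OF L])
    show "openin (top_of_set V) (?L ` U')" if "openin (top_of_set U) U'" for U'
      using that open_map[of U'] oU oV unfolding V_def
      by (auto simp: openin_open_eq)
  qed (auto simp: V_def inv_into_f_f[OF inj])
  have "\<exists>N. N o\<^sub>L A z = id_blinfun \<and> A z o\<^sub>L N = id_blinfun \<and> norm N \<le> 2" if "z \<in> U" for z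
    using that U_Y blinfun_inverse_near_id[of "A z"] by (force simp: Y_def)
  then obtain N where N: "\<And>z. z \<in> U \<Longrightarrow> N z o\<^sub>L A z = id_blinfun"
    "\<And>z. z \<in> U \<Longrightarrow> A z o\<^sub>L N z = id_blinfun" "\<And>z. z \<in> U \<Longrightarrow> norm (N z) \<le> 2"
    by metis
  have sN: "smooth_on U N"
    by (rule smooth_on_blinfun_inverse[OF smooth_on_subset[OF A U_W] oU N])
  let ?c = "\<lambda>z. frechet_derivative l (at z) (0, 1)"
  \<comment> \<open>The Jacobian is block triangular because \<open>h\<close> is preserved;
    \<open>?B\<close> inverts it using the inverse \<open>N\<close> of the diagonal block.\<close>
  let ?D = "\<lambda>z. \<lambda>(v, k). (blinfun_apply (A z) v + k *\<^sub>R ?c z, k)"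
  let ?B = "\<lambda>z. \<lambda>(w, k). (blinfun_apply (N z) (w - k *\<^sub>R ?c z), k)"
  have "smooth_on V ?g"
  proof (rule smooth_on_inverse[OF oU oV gV(1) cont_g gV(2)])
    fix z assume z: "z \<in> U"
    then have zW: "z \<in> W" using U_W by blast
    note Dl = smooth_on_has_derivative[OF l zW]
    have Dlz: "frechet_derivative l (at z) (v, k) = blinfun_apply (A z) v + k *\<^sub>R ?c z" for v k
    proof -
      have "frechet_derivative l (at z) ((v, 0) + k *\<^sub>R (0, 1)) =
          frechet_derivative l (at z) (v, 0) + k *\<^sub>R ?c z"
        using has_derivative_linear[OF Dl] by (simp only: linear_add linear_cmul)
      then show ?thesis
        using blinfun_deriv_apply[OF smooth_on_differentiable[OF l zW]] by (simp add: A_def fibre_deriv_apply)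
    qed
    have "((\<lambda>z. (l z, snd z)) has_derivative (\<lambda>u. (frechet_derivative l (at z) u, snd u))) (at z)"
      by (intro has_derivative_Pair Dl has_derivative_snd has_derivative_ident)
    moreover have "(frechet_derivative l (at z) u, snd u) = ?D z u" for u
      using Dlz[of "fst u" "snd u"] by (simp add: split_beta)
    moreover have "(\<lambda>z. (l z, snd z)) = ?L"
      by auto
    ultimately show "(?L has_derivative ?D z) (at z)"
      by (simp only:)
    have "bounded_linear (\<lambda>u. fst u - snd u *\<^sub>R ?c z)"
      by (rule bounded_linear_sub[OF bounded_linear_fst
            bounded_linear_compose[OF bounded_linear_scaleR_left bounded_linear_snd]])
    then show "bounded_linear (?B z)"
      unfolding split_beta
      by (rule bounded_linear_Pair[OF bounded_linear_compose[OF blinfun.bounded_linear_right]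
            bounded_linear_snd])
    fix u
    have "blinfun_apply (N z) (blinfun_apply (A z) v) = v" for v
      using N(1)[OF z] by (metis blinfun_apply_blinfun_compose blinfun_apply_id_blinfun)
    then show "?B z (?D z u) = u" by (cases u) simp
  next
    fix w
    show "smooth_on U (\<lambda>z. ?B z w)"
      unfolding split_beta
      by (intro smooth_on_Pair smooth_on_bilinear[OF bounded_bilinear_blinfun_apply] sN smooth_on_diff
          smooth_on_const smooth_on_bilinear[OF bounded_bilinear_scaleR] smooth_on_derivative
          smooth_on_subset[OF l U_W] oU)
  qed
  with inj oU oV L have "diffeo_between ?L U V"
    by (simp add: diffeo_between_def bij_betw_def V_def)
  moreover have "nbhd_of_zero_section U" "nbhd_of_zero_section V"
    using oU oV U0 V0 by (auto simp: nbhd_of_zero_section_def)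
  ultimately show ?thesis using U_W that by blast
qed


subsection \<open>Components of covectors\<close>

lemma covector_apply: "blinfun_apply l (v, \<alpha>) = blinfun_apply (qcomp l) v + blinfun_apply \<alpha> (pcomp l)"
  using blinfun.add_right[of l "(v, 0)" "(0, \<alpha>)"] by (simp add: qcomp_apply pcomp_apply)

lemma bounded_linear_qcomp: "bounded_linear (qcomp :: 'q::euclidean_space covector \<Rightarrow> _)"
proof -
  have "bounded_linear (\<lambda>v :: 'q. (v, 0 :: 'q \<Rightarrow>\<^sub>L real))"
    by (intro bounded_linear_Pair bounded_linear_ident bounded_linear_zero)
  then have eq: "qcomp = (\<lambda>l :: 'q covector. l o\<^sub>L Blinfun (\<lambda>v. (v, 0)))"
    by (intro ext blinfun_eqI) (simp add: qcomp_apply bounded_linear_Blinfun_apply)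
  show ?thesis
    unfolding eq by (rule bounded_bilinear.bounded_linear_left[OF bounded_bilinear_blinfun_compose])
qed

text \<open>\<open>pcomp\<close> is a definite description; its expansion in an orthonormal basis
  exhibits the linear dependence on the covector.\<close>

lemma bounded_linear_pcomp: "bounded_linear (pcomp :: 'q::euclidean_space covector \<Rightarrow> _)"
proof -
  have "pcomp l \<bullet> b = blinfun_apply l (0, blinfun_inner_left b)" for l :: "'q covector" and b
    using pcomp_apply[of "blinfun_inner_left b" l] by (simp add: inner_commute)
  then have "pcomp l = (\<Sum>b\<in>Basis. blinfun_apply l (0, blinfun_inner_left b) *\<^sub>R b)" for l :: "'q covector"
    using euclidean_representation[of "pcomp l"] by simp
  then have "pcomp = (\<lambda>l :: 'q covector. \<Sum>b\<in>Basis. blinfun_apply l (0, blinfun_inner_left b) *\<^sub>R b)"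
    by (rule ext)
  moreover have "bounded_linear (\<lambda>l :: 'q covector. \<Sum>b\<in>Basis. blinfun_apply l (0, blinfun_inner_left b) *\<^sub>R b)"
    by (intro bounded_linear_sum bounded_linear_compose[OF bounded_linear_scaleR_left
          blinfun.bounded_linear_left])
  ultimately show ?thesis by (simp only:)
qed

lemma vector_eqI_dual:
  fixes v w :: "'q::euclidean_space"
  assumes "\<And>\<alpha> :: 'q \<Rightarrow>\<^sub>L real. blinfun_apply \<alpha> v = blinfun_apply \<alpha> w"
  shows "v = w"
proof (rule euclidean_eqI)
  show "v \<bullet> b = w \<bullet> b" for b
    using assms[of "blinfun_inner_left b"] by simp
qed

text \<open>The force subtracted in the transforms cancels the force term of the differential,
  leaving the coefficients \<open>p\<close> and \<open>q\<close>. The exact system, and every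
  discretization at \<open>h = 0\<close>, has a differential of this shape.\<close>

lemma legendre_transforms:
  fixes x :: "'q::euclidean_space phase"
  assumes D: "(Hd has_derivative (\<lambda>\<delta>. blinfun_apply (snd \<delta>) q + blinfun_apply p (fst \<delta>) +
    blinfun_apply (\<phi>d x) \<delta>)) (at x)"
  shows "legendre_minus Hd \<phi>d x = (fst x, p)" "legendre_plus Hd \<phi>d x = (q, snd x)"
proof -
  have d: "blinfun_apply (differential Hd x) =
      (\<lambda>\<delta>. blinfun_apply (snd \<delta>) q + blinfun_apply p (fst \<delta>) + blinfun_apply (\<phi>d x) \<delta>)"
    unfolding differential_def frechet_derivative_at[OF D, symmetric]
    by (rule bounded_linear_Blinfun_apply[OF has_derivative_bounded_linear[OF D]])
  have "D1 Hd x = p + qcomp (\<phi>d x)"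
    by (rule blinfun_eqI) (simp add: D1_def qcomp_apply d blinfun.add_left)
  then show "legendre_minus Hd \<phi>d x = (fst x, p)"
    by (simp add: legendre_minus_def)
  have "D2 Hd x = q + pcomp (\<phi>d x)"
    by (rule vector_eqI_dual) (simp add: D2_def pcomp_apply d blinfun.add_right)
  then show "legendre_plus Hd \<phi>d x = (q, snd x)"
    by (simp add: legendre_plus_def)
qed

lemma smooth_D1: "open S \<Longrightarrow> smooth_on S H \<Longrightarrow> smooth_on S (D1 H)"
  and smooth_D2: "open S \<Longrightarrow> smooth_on S H \<Longrightarrow> smooth_on S (D2 H)"
  using smooth_on_linear[OF bounded_linear_qcomp _ smooth_on_blinfun_deriv]
    smooth_on_linear[OF bounded_linear_pcomp _ smooth_on_blinfun_deriv]
  unfolding D1_def[abs_def] D2_def[abs_def] differential_def[abs_def] blinfun_deriv_def[abs_def]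
  by blast+


subsection \<open>Trajectories\<close>

definition vector_field ::
  "('q::euclidean_space phase \<Rightarrow> real) \<Rightarrow> ('q phase \<Rightarrow> 'q covector) \<Rightarrow> 'q phase \<Rightarrow> 'q phase" where
  "vector_field H \<phi> z = (D2 H z, - D1 H z + qcomp (\<phi> z))"

lemma smooth_vector_field:
  "forced_hamiltonian_system H \<phi> \<Longrightarrow> smooth_on UNIV (vector_field H \<phi>)"
  unfolding vector_field_def[abs_def] forced_hamiltonian_system_def
  by (intro smooth_on_Pair smooth_on_add smooth_D1 smooth_D2 smooth_on_linear[OF bounded_linear_qcomp]
      smooth_on_linear[OF bounded_linear_minus[OF bounded_linear_ident]]) auto

lemma closed_segment_0_real: "closed_segment 0 h = (\<lambda>s. s * h) ` {0..1 :: real}"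
  by (auto simp: closed_segment_def image_def)

text \<open>Substituting \<open>t = s * h\<close> turns a segment of either orientation, or a
  degenerate one, into [0, 1], at the price of a factor \<open>h\<close> in front of the vector
  field.\<close>

lemma trajectory_rescaled:
  assumes "trajectory H \<phi> h z" "s \<in> {0..1}"
  shows "((\<lambda>s. z (s * h)) has_vector_derivative h *\<^sub>R vector_field H \<phi> (z (s * h))) (at s within {0..1})"
proof -
  have t: "s * h \<in> closed_segment 0 h"
    using assms(2) by (auto simp: closed_segment_0_real)
  have "((\<lambda>t. (fst (z t), snd (z t))) has_derivative
      (\<lambda>u. (u *\<^sub>R fst (vector_field H \<phi> (z (s * h))), u *\<^sub>R snd (vector_field H \<phi> (z (s * h))))))
      (at (s * h) within closed_segment 0 h)"
    using assms(1) t unfolding trajectory_def has_vector_derivative_def vector_field_def fst_conv snd_conv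
    by (intro has_derivative_Pair) blast+
  then have "(z has_vector_derivative vector_field H \<phi> (z (s * h))) (at (s * h) within (\<lambda>s. s * h) ` {0..1})"
    unfolding has_vector_derivative_def closed_segment_0_real by (simp add: scaleR_prod_def)
  moreover have "((\<lambda>s. s * h) has_vector_derivative h) (at s within {0..1})"
    unfolding has_real_derivative_iff_has_vector_derivative[symmetric]
    by (auto intro!: derivative_eq_intros)
  ultimately show ?thesis
    using vector_diff_chain_within by (fastforce simp: comp_def)
qed

lemma trajectory_unique:
  assumes sys: "forced_hamiltonian_system H \<phi>"
    and "trajectory H \<phi> h z1" "trajectory H \<phi> h z2" "z1 0 = z2 0"
  shows "z1 h = z2 h"
  using ode_unique[OF smooth_vector_field[OF sys] trajectory_rescaled[OF assms(2)]
      trajectory_rescaled[OF assms(3)], of 1] assms(4) by simp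

lemma flow_eq:
  assumes "forced_hamiltonian_system H \<phi>" "trajectory H \<phi> h z"
  shows "flow H \<phi> h (z 0) = z h"
  unfolding flow_def
proof (rule the_equality)
  show "\<exists>z'. trajectory H \<phi> h z' \<and> z' 0 = z 0 \<and> z' h = z h"
    using assms(2) by blast
  show "y = z h" if "\<exists>z'. trajectory H \<phi> h z' \<and> z' 0 = z 0 \<and> z' h = y" for y
    using that trajectory_unique[OF assms(1) _ assms(2)] by blast
qed

text \<open>The substitution absorbs the orientation into the factor \<open>h\<close>. The result is
  an integral over a fixed interval with \<open>h\<close> as an ordinary parameter, to which
  differentiation under the integral applies.\<close>

lemma interval_integral_rescale:
  fixes g :: "real \<Rightarrow> real"
  assumes "continuous_on (closed_segment 0 h) g"
  shows "(LBINT t=ereal 0..ereal h. g t) = integral {0..1} (\<lambda>s. h * g (s * h))"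
proof -
  have g: "continuous_on ((\<lambda>s. s * h) ` {0..1}) g"
    using assms by (simp add: closed_segment_0_real)
  have "(LBINT s=ereal 0..ereal 1. h *\<^sub>R g (s * h)) = (LBINT t=ereal (0 * h)..ereal (1 * h). g t)"
    by (rule interval_integral_substitution_finite[OF _ _ g]) (auto intro!: derivative_eq_intros)
  moreover have "continuous_on {0..1} (\<lambda>s. h *\<^sub>R g (s * h))"
    by (intro continuous_intros continuous_on_compose2[OF g]) auto
  then have "set_integrable lborel {0..1} (\<lambda>s. h *\<^sub>R g (s * h))"
    by (rule borel_integrable_atLeastAtMost')
  ultimately show ?thesis
    by (subst (asm) interval_integral_eq_integral) auto
qed

text \<open>The integrands of the exact discretization contain derivatives in the two-sided sense,
  while a trajectory is differentiable only within its segment. They agree on the interior, and the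
  oriented integral depends on nothing else.\<close>

lemma einterval_0_real: "t \<in> einterval (min (ereal 0) (ereal h)) (max (ereal 0) (ereal h)) \<longleftrightarrow>
    t \<in> interior (closed_segment 0 h)"
  by (auto simp: closed_segment_eq_real_ivl einterval_def min_def max_def)


subsection \<open>The exact discretization\<close>

text \<open>Names the smooth extension \<open>G\<close> and its open domain \<open>\<Omega>\<close>,
  which are only existentially quantified in \<open>boundary_value_flow\<close>: derivatives are
  taken of \<open>G\<close>, then transferred to \<open>F\<close>.\<close>

locale smooth_boundary_flow =
  fixes H :: "'q::euclidean_space phase \<Rightarrow> real" and \<phi> :: "'q phase \<Rightarrow> 'q covector"
    and W :: "('q phase \<times> real) set" and F :: "real \<Rightarrow> real \<Rightarrow> 'q phase \<Rightarrow> 'q phase"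
    and \<Omega> :: "(real \<times> real \<times> 'q phase) set" and G :: "real \<times> real \<times> 'q phase \<Rightarrow> 'q phase"
  assumes sys: "forced_hamiltonian_system H \<phi>"
    and W: "nbhd_of_zero_section W"
    and traj: "(x, h) \<in> W \<Longrightarrow> trajectory H \<phi> h (\<lambda>t. F h t x)"
    and initial: "(x, h) \<in> W \<Longrightarrow> fst (F h 0 x) = fst x"
    and final: "(x, h) \<in> W \<Longrightarrow> snd (F h h x) = snd x"
    and \<Omega>: "open \<Omega>" and G: "smooth_on \<Omega> G"
    and \<Omega>_W: "(x, h) \<in> W \<Longrightarrow> t \<in> closed_segment 0 h \<Longrightarrow> (t, h, x) \<in> \<Omega>"
    and G_F: "(x, h) \<in> W \<Longrightarrow> t \<in> closed_segment 0 h \<Longrightarrow> G (t, h, x) = F h t x"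
begin

lemma open_W: "open W" and zero_W: "(x, 0) \<in> W"
  using W by (auto simp: nbhd_of_zero_section_def)

lemma smooth_H: "smooth_on UNIV H" and smooth_\<phi>: "smooth_on UNIV \<phi>"
  and \<phi>_horizontal: "blinfun_apply (\<phi> z) \<delta> = blinfun_apply (qcomp (\<phi> z)) (fst \<delta>)"
proof -
  show "smooth_on UNIV H" "smooth_on UNIV \<phi>"
    using sys by (auto simp: forced_hamiltonian_system_def)
  obtain \<psi> where "blinfun_apply (\<phi> x) (v, \<alpha>) = blinfun_apply (\<psi> x) v" for x v \<alpha>
    using sys by (auto simp: forced_hamiltonian_system_def horizontal_def)
  then show "blinfun_apply (\<phi> z) \<delta> = blinfun_apply (qcomp (\<phi> z)) (fst \<delta>)"
    by (cases \<delta>) (simp add: qcomp_apply)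
qed

text \<open>The trajectories in rescaled time \<open>s = t / h\<close>, which makes sense for \<open>h = 0\<close>, too.\<close>

definition Z :: "real \<times> 'q phase \<times> real \<Rightarrow> 'q phase" where
  "Z = (\<lambda>(s, x, h). G (s * h, h, x))"

text \<open>An open domain of smoothness for \<open>Z\<close>. It contains all points with
  \<open>s\<close> in [0, 1] over \<open>W\<close>, end points included, as integration over the
  closed interval requires.\<close>

definition S :: "(real \<times> 'q phase \<times> real) set" where
  "S = (\<lambda>(s, x, h). (s * h, h, x)) -` \<Omega>"

lemma rescaled_in_segment: "(s :: real) \<in> {0..1} \<Longrightarrow> s * h \<in> closed_segment 0 h"
  unfolding closed_segment_0_real by (rule image_eqI[OF refl])

lemma open_S: "open S"
  unfolding S_def split_beta by (intro open_vimage[OF \<Omega>] continuous_intros)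

lemma S_W: "{0..1} \<times> W \<subseteq> S"
  by (auto simp: S_def intro!: \<Omega>_W rescaled_in_segment)

lemma smooth_Z: "smooth_on S Z"
proof -
  have "smooth_on S (\<lambda>p. (fst p * snd (snd p), snd (snd p), fst (snd p)))"
    by (intro smooth_on_Pair smooth_on_bilinear[OF bounded_bilinear_mult] smooth_on_fst smooth_on_snd
        smooth_on_ident open_S)
  moreover have "(\<lambda>p. (fst p * snd (snd p), snd (snd p), fst (snd p))) ` S \<subseteq> \<Omega>"
    by (auto simp: S_def)
  ultimately have "smooth_on S (\<lambda>p. G (fst p * snd (snd p), snd (snd p), fst (snd p)))"
    by (rule smooth_on_compose[OF G \<Omega> open_S])
  then show ?thesis by (simp add: Z_def case_prod_unfold)
qed

lemma Z_F: "(x, h) \<in> W \<Longrightarrow> s \<in> {0..1} \<Longrightarrow> Z (s, x, h) = F h (s * h) x"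
  by (simp add: Z_def G_F rescaled_in_segment)

lemma Z_initial: "(x, h) \<in> W \<Longrightarrow> fst (Z (0, x, h)) = fst x"
  and Z_final: "(x, h) \<in> W \<Longrightarrow> snd (Z (1, x, h)) = snd x"
  by (simp_all add: Z_F initial final)

text \<open>At \<open>h = 0\<close> the trajectory is a single point at which both boundary
  conditions hold simultaneously, one for the position and one for the momentum.\<close>

lemma Z_zero: "Z (s, x, 0) = x"
proof -
  have "Z (s, x, 0) = F 0 0 x"
    using Z_F[OF zero_W, of 0 x] by (simp add: Z_def)
  then show ?thesis
    using initial[OF zero_W, of x] final[OF zero_W, of x] by (simp add: prod_eq_iff)
qed

lemma Z_derivative:
  assumes "(x, h) \<in> W" "s \<in> {0..1}"
  shows "((\<lambda>s. Z (s, x, h)) has_vector_derivative h *\<^sub>R vector_field H \<phi> (Z (s, x, h))) (at s within {0..1})"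
proof (rule has_vector_derivative_transform[OF assms(2)])
  show "((\<lambda>s. F h (s * h) x) has_vector_derivative h *\<^sub>R vector_field H \<phi> (Z (s, x, h))) (at s within {0..1})"
    using trajectory_rescaled[OF traj[OF assms(1)] assms(2)] by (simp add: Z_F[OF assms])
qed (simp add: Z_F[OF assms(1)])

text \<open>The action integrand p q' - H in rescaled time, with the velocity replaced by its value
  from Hamilton's equations. The factor \<open>h\<close> makes it vanish at
  \<open>h = 0\<close>.\<close>

definition K :: "real \<times> 'q phase \<times> real \<Rightarrow> real" where
  "K = (\<lambda>p. snd (snd p) * (blinfun_apply (snd (Z p)) (D2 H (Z p)) - H (Z p)))"

lemma smooth_K: "smooth_on S K"
  unfolding K_def
  by (intro smooth_on_bilinear[OF bounded_bilinear_mult] smooth_on_diff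
      smooth_on_bilinear[OF bounded_bilinear_blinfun_apply] smooth_on_compose[OF smooth_D2[OF open_UNIV smooth_H]]
      smooth_on_compose[OF smooth_H] smooth_on_fst smooth_on_snd smooth_on_ident smooth_Z open_S) auto

text \<open>One expression also covers \<open>h = 0\<close>, which \<open>exact_H\<close> sets
  apart: there the integral vanishes and the boundary term is the pairing of momentum and position.
  Smoothness across \<open>h = 0\<close> is read off this form.\<close>

lemma exact_H_eq:
  assumes W: "(x, h) \<in> W"
  shows "exact_H H F h x = blinfun_apply (snd x) (fst (Z (1, x, h))) - integral {0..1} (\<lambda>s. K (s, x, h))"
proof (cases "h = 0")
  case True
  then show ?thesis by (simp add: exact_H_def K_def Z_zero)
next
  case False
  let ?g = "\<lambda>t. blinfun_apply (snd (G (t, h, x))) (D2 H (G (t, h, x))) - H (G (t, h, x))"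
  have G_cont: "continuous_on (closed_segment 0 h) (\<lambda>t. G (t, h, x))"
    using \<Omega>_W[OF W] by (intro continuous_on_compose2[OF smooth_on_continuous[OF G]] continuous_intros) auto
  have "(LBINT t=ereal 0..ereal h. blinfun_apply (snd (F h t x)) (vector_derivative (\<lambda>s. fst (F h s x)) (at t)) -
      H (F h t x)) = (LBINT t=ereal 0..ereal h. ?g t)"
  proof (rule interval_integral_cong)
    fix t assume "t \<in> einterval (min (ereal 0) (ereal h)) (max (ereal 0) (ereal h))"
    then have t: "t \<in> interior (closed_segment 0 h)"
      by (simp only: einterval_0_real)
    then have t': "t \<in> closed_segment 0 h"
      using interior_subset by blast
    then have "((\<lambda>s. fst (F h s x)) has_vector_derivative D2 H (F h t x)) (at t)"
      using traj[OF W] unfolding trajectory_def at_within_interior[OF t, symmetric] by blast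
    then show "blinfun_apply (snd (F h t x)) (vector_derivative (\<lambda>s. fst (F h s x)) (at t)) - H (F h t x) = ?g t"
      by (simp add: vector_derivative_at G_F[OF W t'])
  qed
  also have "\<dots> = integral {0..1} (\<lambda>s. h * ?g (s * h))"
    by (intro interval_integral_rescale continuous_intros G_cont
        continuous_on_compose2[OF smooth_on_continuous[OF smooth_D2[OF open_UNIV smooth_H]] G_cont]
        continuous_on_compose2[OF smooth_on_continuous[OF smooth_H] G_cont]) auto
  finally show ?thesis
    using False Z_F[OF W, of 1] Z_final[OF W] by (simp add: exact_H_def K_def Z_def)
qed

lemma smooth_exact_H: "smooth_on W (\<lambda>(x, h). exact_H H F h x)"
proof (rule smooth_on_cong[OF _ open_W])
  have "(\<lambda>p. (1, p)) ` W \<subseteq> S" using S_W by auto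
  then have "smooth_on W (\<lambda>p. Z (1, p))"
    by (intro smooth_on_compose[OF smooth_Z open_S] smooth_on_Pair smooth_on_const smooth_on_ident open_W)
  then show "smooth_on W (\<lambda>p. blinfun_apply (snd (fst p)) (fst (Z (1, p))) - integral {0..1} (\<lambda>s. K (s, p)))"
    by (intro smooth_on_diff smooth_on_bilinear[OF bounded_bilinear_blinfun_apply] smooth_on_fst smooth_on_snd
        smooth_on_ident smooth_on_param_integral[OF smooth_K open_S S_W] open_W)
qed (auto simp: exact_H_eq)

text \<open>Hamilton's equations turn the first variation of the action into a boundary term plus the
  virtual work of the force. That \<open>\<partial>\<^sub>s\<close> commutes with the variation of \<open>q\<close> is read off the integrated
  equation for \<open>q\<close>.\<close>

lemma exact_H_derivative:
  assumes W: "(x, h) \<in> W"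
  shows "(exact_H H F h has_derivative (\<lambda>\<delta>. blinfun_apply (snd \<delta>) (fst (Z (1, x, h))) +
    blinfun_apply (snd (Z (0, x, h))) (fst \<delta>) + blinfun_apply (exact_\<phi> \<phi> F h x) \<delta>)) (at x)"
proof -
  define U where "U = (\<lambda>x. (x, h)) -` W"
  have U: "open U" "x \<in> U"
    using W by (auto simp: U_def intro!: open_vimage[OF open_W] continuous_intros)
  define Sh where "Sh = (\<lambda>(s, x). (s, x, h)) -` S"
  define Y where "Y = (\<lambda>(s, x). Z (s, x, h))"
  have Sh: "open Sh"
    unfolding Sh_def split_beta by (intro open_vimage[OF open_S] continuous_intros)
  have Sh_U: "{a..b} \<times> U \<subseteq> Sh" if "{a..b} \<subseteq> {0..1}" for a b
    using that S_W by (fastforce simp: U_def Sh_def)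
  have sub: "(s, y) \<in> Sh" if "s \<in> {0..1}" "y \<in> U" for s y
    using Sh_U[of 0 1] that by auto
  have Y: "smooth_on Sh Y"
  proof -
    have "smooth_on Sh (\<lambda>p. Z (fst p, snd p, h))"
      by (intro smooth_on_compose[OF smooth_Z open_S] smooth_on_Pair smooth_on_fst smooth_on_snd
          smooth_on_ident smooth_on_const Sh) (auto simp: Sh_def)
    then show ?thesis by (simp add: Y_def case_prod_unfold)
  qed
  define f where "f = (\<lambda>p. h *\<^sub>R D2 H (Y p))"
  have f: "smooth_on Sh f"
    unfolding f_def
    by (intro smooth_on_linear[OF bounded_linear_scaleR_right] smooth_on_compose[OF smooth_D2[OF open_UNIV smooth_H]]
        Y Sh) auto
  define k where "k = (\<lambda>p. blinfun_apply (snd (Y p)) (f p) - h * H (Y p))"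
  have k: "smooth_on Sh k"
    unfolding k_def
    by (intro smooth_on_diff smooth_on_bilinear[OF bounded_bilinear_blinfun_apply] smooth_on_snd Y f
        smooth_on_linear[OF bounded_linear_mult_right] smooth_on_compose[OF smooth_H] Sh) auto
  have k_K: "k (s, y) = K (s, y, h)" for s y
    by (simp add: k_def f_def K_def Y_def blinfun.scaleR_right right_diff_distrib)
  let ?DY = "\<lambda>s \<delta>. frechet_derivative Y (at (s, x)) (0, \<delta>)"
  let ?Df = "\<lambda>s \<delta>. frechet_derivative f (at (s, x)) (0, \<delta>)"
  let ?p' = "\<lambda>s. h *\<^sub>R (- D1 H (Y (s, x)) + qcomp (\<phi> (Y (s, x))))"
  have Y_s: "((\<lambda>s. fst (Y (s, y))) has_vector_derivative f (s, y)) (at s within {0..1})"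
    "((\<lambda>s. snd (Y (s, y))) has_vector_derivative h *\<^sub>R (- D1 H (Y (s, y)) + qcomp (\<phi> (Y (s, y))))) (at s within {0..1})"
    if "y \<in> U" "s \<in> {0..1}" for y s
    using bounded_linear.has_vector_derivative[OF bounded_linear_fst Z_derivative[of y h s]]
      bounded_linear.has_vector_derivative[OF bounded_linear_snd Z_derivative[of y h s]] that
    by (simp_all add: U_def Y_def f_def vector_field_def)
  have Y_x: "((\<lambda>y. Y (s, y)) has_derivative ?DY s) (at x)" if "s \<in> {0..1}" for s
    using smooth_on_has_derivative[OF Y sub[OF that U(2)]]
    by (intro has_derivative_compose[of "Pair s" "Pair 0" x UNIV Y]) (auto intro!: derivative_eq_intros)
  have q_eq: "fst (Y (s, y)) = fst y + integral {0..s} (\<lambda>\<tau>. f (\<tau>, y))" if "y \<in> U" "s \<in> {0..1}" for y s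
  proof -
    have "((\<lambda>\<tau>. f (\<tau>, y)) has_integral fst (Y (s, y)) - fst (Y (0, y))) {0..s}"
      using that by (intro fundamental_theorem_of_calculus has_vector_derivative_within_subset[OF Y_s(1)]) auto
    then show ?thesis
      using that Z_initial[of y h] by (auto dest!: integral_unique simp: Y_def U_def)
  qed
  have dq: "fst (?DY s \<delta>) = fst \<delta> + integral {0..s} (\<lambda>\<tau>. ?Df \<tau> \<delta>)" if "s \<in> {0..1}" for s \<delta>
  proof -
    have "((\<lambda>y. fst y + integral {0..s} (\<lambda>\<tau>. f (\<tau>, y))) has_derivative
        (\<lambda>\<delta>. fst \<delta> + integral {0..s} (\<lambda>\<tau>. ?Df \<tau> \<delta>))) (at x)"
      using that by (intro has_derivative_add has_derivative_fst has_derivative_ident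
          has_derivative_param_integral[OF f Sh Sh_U U]) auto
    then have D: "((\<lambda>y. fst (Y (s, y))) has_derivative (\<lambda>\<delta>. fst \<delta> + integral {0..s} (\<lambda>\<tau>. ?Df \<tau> \<delta>))) (at x)"
      by (rule has_derivative_transform_within_open[OF _ U]) (simp add: q_eq[OF _ that])
    show ?thesis
      by (rule fun_cong[OF has_derivative_unique[OF has_derivative_fst[OF Y_x[OF that]] D]])
  qed
  have Df_cont: "continuous_on {0..1} (\<lambda>s. ?Df s \<delta>)" for \<delta>
    using sub U by (intro continuous_on_compose2[OF smooth_on_continuous[OF smooth_on_derivative[OF f]]]
        continuous_intros) auto
  have dq_s: "((\<lambda>s. fst (?DY s \<delta>)) has_vector_derivative ?Df s \<delta>) (at s within {0..1})"
    if "s \<in> {0..1}" for s \<delta>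
  proof (rule has_vector_derivative_transform[OF that])
    show "((\<lambda>s. fst \<delta> + integral {0..s} (\<lambda>\<tau>. ?Df \<tau> \<delta>)) has_vector_derivative ?Df s \<delta>) (at s within {0..1})"
      by (rule has_vector_derivative_eq_rhs[OF has_vector_derivative_add[OF has_vector_derivative_const
              integral_has_vector_derivative[OF Df_cont that]] add_0])
  qed (simp add: dq[simplified])
  define I where "I = (\<lambda>\<delta>. integral {0..1} (\<lambda>s. h * blinfun_apply (\<phi> (Y (s, x))) (?DY s \<delta>)))"
  have Y_cont: "continuous_on {0..1} (\<lambda>s. Y (s, x))"
    using sub U by (intro continuous_on_compose2[OF smooth_on_continuous[OF Y]] continuous_intros) auto
  have DY_cont: "continuous_on {0..1} (\<lambda>s. ?DY s \<delta>)" for \<delta>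
    using sub U by (intro continuous_on_compose2[OF smooth_on_continuous[OF smooth_on_derivative[OF Y]]]
        continuous_intros) auto
  have I_integrable: "(\<lambda>s. h * blinfun_apply (\<phi> (Y (s, x))) (?DY s \<delta>)) integrable_on {0..1}" for \<delta>
    by (intro integrable_continuous_interval continuous_intros DY_cont
        continuous_on_compose2[OF smooth_on_continuous[OF smooth_\<phi>] Y_cont]) auto
  \<comment> \<open>Integration by parts: the integrand is the derivative of p(s) applied to the
    variation of q(s). At \<open>s = 1\<close> the momentum is prescribed, at \<open>s = 0\<close>
    the variation of the position is.\<close>
  have boundary: "((\<lambda>s. blinfun_apply (snd (Y (s, x))) (?Df s \<delta>) + blinfun_apply (?p' s) (fst (?DY s \<delta>)))
      has_integral blinfun_apply (snd x) (fst (?DY 1 \<delta>)) - blinfun_apply (snd (Y (0, x))) (fst \<delta>)) {0..1}" for \<delta>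
  proof -
    have "((\<lambda>s. blinfun_apply (snd (Y (s, x))) (?Df s \<delta>) + blinfun_apply (?p' s) (fst (?DY s \<delta>)))
      has_integral blinfun_apply (snd (Y (1, x))) (fst (?DY 1 \<delta>)) - blinfun_apply (snd (Y (0, x))) (fst (?DY 0 \<delta>))) {0..1}"
      using U by (intro fundamental_theorem_of_calculus
          bounded_bilinear.has_vector_derivative[OF bounded_bilinear_blinfun_apply] Y_s dq_s) auto
    then show ?thesis
      using Z_final[OF W] dq[of 0 \<delta>] by (simp add: Y_def)
  qed
  \<comment> \<open>Because \<open>f\<close> is \<open>h\<close> times \<open>D2 H\<close>, the
    variation of the momentum drops out. What remains of the energy term is \<open>?p'\<close>
    without its force part; horizontality rewrites that part as the force applied to the full
    variation.\<close>
  have Dk: "frechet_derivative k (at (s, x)) (0, \<delta>) =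
      (blinfun_apply (snd (Y (s, x))) (?Df s \<delta>) + blinfun_apply (?p' s) (fst (?DY s \<delta>))) -
      h * blinfun_apply (\<phi> (Y (s, x))) (?DY s \<delta>)" if s: "s \<in> {0..1}" for s \<delta>
  proof -
    note DY = smooth_on_has_derivative[OF Y sub[OF s U(2)]]
      and Df = smooth_on_has_derivative[OF f sub[OF s U(2)]]
    have DH: "(H has_derivative blinfun_apply (differential H z)) (at z)" for z
      using smooth_on_has_blinfun_deriv[OF smooth_H, of z]
      by (simp add: differential_def blinfun_deriv_def)
    have D: "(k has_derivative (\<lambda>u. blinfun_apply (snd (Y (s, x))) (frechet_derivative f (at (s, x)) u) +
        blinfun_apply (snd (frechet_derivative Y (at (s, x)) u)) (f (s, x)) -
        h * blinfun_apply (differential H (Y (s, x))) (frechet_derivative Y (at (s, x)) u))) (at (s, x))"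
      unfolding k_def
      by (intro has_derivative_diff bounded_bilinear.FDERIV[OF bounded_bilinear_blinfun_apply]
          has_derivative_snd has_derivative_mult_right has_derivative_compose[OF DY DH] DY Df)
    have "frechet_derivative k (at (s, x)) (0, \<delta>) = blinfun_apply (snd (Y (s, x))) (?Df s \<delta>) +
        blinfun_apply (snd (?DY s \<delta>)) (f (s, x)) - h * blinfun_apply (differential H (Y (s, x))) (?DY s \<delta>)"
      by (rule fun_cong[OF frechet_derivative_at[OF D], symmetric])
    moreover have "blinfun_apply (differential H (Y (s, x))) (?DY s \<delta>) =
        blinfun_apply (D1 H (Y (s, x))) (fst (?DY s \<delta>)) + blinfun_apply (snd (?DY s \<delta>)) (D2 H (Y (s, x)))"
      using covector_apply[of "differential H (Y (s, x))" "fst (?DY s \<delta>)" "snd (?DY s \<delta>)"]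
      by (simp add: D1_def D2_def)
    ultimately show ?thesis
      by (simp add: \<phi>_horizontal[of _ "?DY s \<delta>"] f_def blinfun.bilinear_simps algebra_simps)
  qed
  have D: "(exact_H H F h has_derivative (\<lambda>\<delta>. blinfun_apply (snd \<delta>) (fst (Y (1, x))) +
    blinfun_apply (snd (Y (0, x))) (fst \<delta>) + I \<delta>)) (at x)"
  proof -
    have "((\<lambda>y. blinfun_apply (snd y) (fst (Y (1, y))) - integral {0..1} (\<lambda>s. k (s, y))) has_derivative
      (\<lambda>\<delta>. blinfun_apply (snd x) (fst (?DY 1 \<delta>)) + blinfun_apply (snd \<delta>) (fst (Y (1, x))) -
        integral {0..1} (\<lambda>s. frechet_derivative k (at (s, x)) (0, \<delta>)))) (at x)"
      by (intro has_derivative_diff bounded_bilinear.FDERIV[OF bounded_bilinear_blinfun_apply]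
          has_derivative_snd has_derivative_fst has_derivative_ident Y_x
          has_derivative_param_integral[OF k Sh Sh_U U]) auto
    then have "(exact_H H F h has_derivative
      (\<lambda>\<delta>. blinfun_apply (snd x) (fst (?DY 1 \<delta>)) + blinfun_apply (snd \<delta>) (fst (Y (1, x))) -
        integral {0..1} (\<lambda>s. frechet_derivative k (at (s, x)) (0, \<delta>)))) (at x)"
      by (rule has_derivative_transform_within_open[OF _ U]) (simp add: exact_H_eq k_K Y_def U_def)
    moreover have "integral {0..1} (\<lambda>s. frechet_derivative k (at (s, x)) (0, \<delta>)) =
        blinfun_apply (snd x) (fst (?DY 1 \<delta>)) - blinfun_apply (snd (Y (0, x))) (fst \<delta>) - I \<delta>" for \<delta>
    proof (rule integral_unique, rule has_integral_eq)
      show "((\<lambda>s. (blinfun_apply (snd (Y (s, x))) (?Df s \<delta>) + blinfun_apply (?p' s) (fst (?DY s \<delta>))) -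
          h * blinfun_apply (\<phi> (Y (s, x))) (?DY s \<delta>)) has_integral
        blinfun_apply (snd x) (fst (?DY 1 \<delta>)) - blinfun_apply (snd (Y (0, x))) (fst \<delta>) - I \<delta>) {0..1}"
        unfolding I_def by (intro has_integral_diff boundary integrable_integral I_integrable)
    qed (simp add: Dk)
    ultimately show ?thesis by (simp add: algebra_simps)
  qed
  \<comment> \<open>\<open>I\<close> is the derivative in \<open>D\<close> minus explicit linear
    terms, hence bounded linear itself; this is what makes \<open>Blinfun I\<close> evaluate to
    \<open>I\<close>.\<close>
  have I: "bounded_linear I"
  proof -
    have "bounded_linear (\<lambda>\<delta> :: 'q phase. blinfun_apply (snd \<delta>) (fst (Y (1, x))) + blinfun_apply (snd (Y (0, x))) (fst \<delta>))"
      by (intro bounded_linear_add bounded_linear_compose[OF blinfun.bounded_linear_left bounded_linear_snd]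
          bounded_linear_compose[OF blinfun.bounded_linear_right bounded_linear_fst])
    from bounded_linear_sub[OF has_derivative_bounded_linear[OF D] this] show ?thesis by simp
  qed
  have "exact_\<phi> \<phi> F h x = Blinfun I"
  proof (cases "h = 0")
    case True
    then show ?thesis by (simp add: exact_\<phi>_def I_def zero_blinfun_def)
  next
    case False
    have "(LBINT t=ereal 0..ereal h. blinfun_apply (\<phi> (F h t x)) (frechet_derivative (F h t) (at x) \<delta>)) = I \<delta>" for \<delta>
    proof -
      let ?DG = "\<lambda>t. frechet_derivative G (at (t, h, x)) (0, 0, \<delta>)"
      have G_x: "((\<lambda>y. G (t, h, y)) has_derivative (\<lambda>\<delta>. frechet_derivative G (at (t, h, x)) (0, 0, \<delta>))) (at x)"
        if "t \<in> closed_segment 0 h" for t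
        using smooth_on_has_derivative[OF G \<Omega>_W[OF W that]]
        by (intro has_derivative_compose[of "\<lambda>y. (t, h, y)" "\<lambda>\<delta>. (0, 0, \<delta>)" x UNIV G])
          (auto intro!: derivative_eq_intros)
      have "(LBINT t=ereal 0..ereal h. blinfun_apply (\<phi> (F h t x)) (frechet_derivative (F h t) (at x) \<delta>)) =
          (LBINT t=ereal 0..ereal h. blinfun_apply (\<phi> (G (t, h, x))) (?DG t))"
      proof (rule interval_integral_cong)
        fix t assume "t \<in> einterval (min (ereal 0) (ereal h)) (max (ereal 0) (ereal h))"
        then have t: "t \<in> closed_segment 0 h"
          using interior_subset unfolding einterval_0_real by blast
        \<comment> \<open>For \<open>t\<close> in the segment, \<open>F h t\<close> agrees with the
          slice of \<open>G\<close> on the neighbourhood \<open>U\<close> of \<open>x\<close>, so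
          both have the same derivative there.\<close>
        have "(F h t has_derivative (\<lambda>\<delta>. frechet_derivative G (at (t, h, x)) (0, 0, \<delta>))) (at x)"
          by (rule has_derivative_transform_within_open[OF G_x[OF t] U]) (simp add: G_F t U_def)
        then show "blinfun_apply (\<phi> (F h t x)) (frechet_derivative (F h t) (at x) \<delta>) =
            blinfun_apply (\<phi> (G (t, h, x))) (?DG t)"
          using G_F[OF W t] by (simp flip: frechet_derivative_at)
      qed
      also have "\<dots> = integral {0..1} (\<lambda>s. h * blinfun_apply (\<phi> (G (s * h, h, x))) (?DG (s * h)))"
        using \<Omega>_W[OF W]
        by (intro interval_integral_rescale continuous_intros
            continuous_on_compose2[OF smooth_on_continuous[OF smooth_on_derivative[OF G]]]
            continuous_on_compose2[OF smooth_on_continuous[OF smooth_\<phi>]]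
            continuous_on_compose2[OF smooth_on_continuous[OF G]]) auto
      also have "\<dots> = I \<delta>"
        unfolding I_def
      proof (rule integral_cong)
        fix s :: real assume s: "s \<in> {0..1}"
        have "(\<lambda>y. Y (s, y)) = (\<lambda>y. G (s * h, h, y))"
          by (simp add: Y_def Z_def)
        with Y_x[OF s] have D: "((\<lambda>y. G (s * h, h, y)) has_derivative ?DY s) (at x)"
          by (simp only:)
        have "?DG (s * h) = ?DY s \<delta>"
          by (rule fun_cong[OF has_derivative_unique[OF G_x[OF rescaled_in_segment[OF s]] D]])
        then show "h * blinfun_apply (\<phi> (G (s * h, h, x))) (?DG (s * h)) =
            h * blinfun_apply (\<phi> (Y (s, x))) (?DY s \<delta>)"
          by (simp only: Y_def Z_def prod.case)
      qed
      finally show ?thesis .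
    qed
    with False show ?thesis by (simp add: exact_\<phi>_def)
  qed
  then have "blinfun_apply (exact_\<phi> \<phi> F h x) = I"
    by (simp add: bounded_linear_Blinfun_apply[OF I])
  with D show ?thesis by (simp add: Y_def)
qed

lemma legendre_exact:
  assumes "(x, h) \<in> W"
  shows "legendre_minus (exact_H H F h) (exact_\<phi> \<phi> F h) x = F h 0 x"
    and "legendre_plus (exact_H H F h) (exact_\<phi> \<phi> F h) x = F h h x"
  using legendre_transforms[where \<phi>d = "exact_\<phi> \<phi> F h", OF exact_H_derivative[OF assms]] Z_initial[OF assms] Z_final[OF assms]
    Z_F[OF assms, of 0] Z_F[OF assms, of 1] by (auto simp: prod_eq_iff)

text \<open>The exact transforms are end points of rescaled trajectories, so their smoothness is
  that of \<open>Z\<close> at \<open>s = 0\<close> and \<open>s = 1\<close>.\<close>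

lemma smooth_legendre_exact:
  "smooth_on W (\<lambda>(x, h). legendre_minus (exact_H H F h) (exact_\<phi> \<phi> F h) x)" (is ?minus)
  "smooth_on W (\<lambda>(x, h). legendre_plus (exact_H H F h) (exact_\<phi> \<phi> F h) x)" (is ?plus)
proof -
  have Z: "smooth_on W (\<lambda>p. Z (c, p))" if "c \<in> {0..1}" for c
    using S_W that
    by (intro smooth_on_compose[OF smooth_Z open_S] smooth_on_Pair smooth_on_const smooth_on_ident open_W) auto
  show ?minus by (rule smooth_on_cong[OF Z[of 0] open_W]) (auto simp: legendre_exact Z_F)
  show ?plus by (rule smooth_on_cong[OF Z[of 1] open_W]) (auto simp: legendre_exact Z_F)
qed

end


subsection \<open>Discrete flows\<close>

text \<open>Brings the differential of a single slice \<open>Hd h\<close> under the calculus of maps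
  that are jointly smooth in \<open>(x, h)\<close>.\<close>

lemma differential_fibre:
  assumes "smooth_on W (\<lambda>(x, h). Hd h x)" "(x, h) \<in> W"
  shows "differential (Hd h) x = fibre_deriv (\<lambda>(x, h). Hd h x) (x, h)"
  using has_derivative_fibre[OF assms] unfolding differential_def
  by (simp add: frechet_derivative_at[symmetric] blinfun_apply_inverse)

lemma smooth_legendre_minus:
  assumes "smooth_family W Hd \<phi>d"
  shows "smooth_on W (\<lambda>(x, h). legendre_minus (Hd h) (\<phi>d h) x)"
proof -
  have oW: "open W" and H: "smooth_on W (\<lambda>(x, h). Hd h x)" and \<phi>: "smooth_on W (\<lambda>(x, h). \<phi>d h x)"
    using assms by (auto simp: smooth_family_def nbhd_of_zero_section_def)
  let ?D = "fibre_deriv (\<lambda>(x, h). Hd h x)" and ?\<phi> = "\<lambda>(x, h). \<phi>d h x"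
  have "smooth_on W (\<lambda>z. (fst (fst z), qcomp (?D z) - qcomp (?\<phi> z)))"
    by (intro smooth_on_Pair smooth_on_diff smooth_on_fst smooth_on_ident smooth_on_linear[OF bounded_linear_qcomp]
        smooth_on_fibre_deriv oW H \<phi>)
  then show ?thesis
    by (rule smooth_on_cong[OF _ oW]) (auto simp: legendre_minus_def D1_def differential_fibre[OF H])
qed

lemma equal_up_to_Suc_zero: "equal_up_to (Suc k) W1 f1 W2 f2 \<Longrightarrow> f2 0 x = f1 0 x"
  by (force simp: equal_up_to_def nbhd_of_zero_section_def)

text \<open>Agreement up to second order in \<open>h\<close> already fixes the values at
  \<open>h = 0\<close>: the force vanishes and \<open>Hd\<close> is the pairing of momentum and
  position, the generating function of the identity.\<close>

lemma discretization_legendre_zero: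
  assumes "discretization H \<phi> W Hd \<phi>d"
  shows "legendre_minus (Hd 0) (\<phi>d 0) x = x"
proof -
  have "Hd 0 = (\<lambda>x. blinfun_apply (snd x) (fst x))" and \<phi>: "\<phi>d 0 x = 0"
    using assms equal_up_to_Suc_zero[where k = 1] by (fastforce simp: discretization_def numeral_2_eq_2)+
  moreover have "((\<lambda>x. blinfun_apply (snd x) (fst x)) has_derivative
      (\<lambda>\<delta>. blinfun_apply (snd \<delta>) (fst x) + blinfun_apply (snd x) (fst \<delta>) + blinfun_apply (\<phi>d 0 x) \<delta>)) (at x)"
    by (rule has_derivative_eq_rhs[OF bounded_bilinear.FDERIV[OF bounded_bilinear_blinfun_apply
            has_derivative_snd[OF has_derivative_ident] has_derivative_fst[OF has_derivative_ident]]])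
      (simp add: \<phi> add.commute)
  ultimately have "(Hd 0 has_derivative
      (\<lambda>\<delta>. blinfun_apply (snd \<delta>) (fst x) + blinfun_apply (snd x) (fst \<delta>) + blinfun_apply (\<phi>d 0 x) \<delta>)) (at x)"
    by (simp only:)
  from legendre_transforms(1)[where \<phi>d = "\<phi>d 0", OF this] show ?thesis by simp
qed

lemma ex_inversion_domains:
  assumes "nbhd_of_zero_section W" "smooth_on W (\<lambda>(x, h). legendre_minus (Hd h) (\<phi>d h) x)"
    and "\<And>x. legendre_minus (Hd 0) (\<phi>d 0) x = x"
  shows "\<exists>U V. inversion_domains W Hd \<phi>d U V"
proof -
  obtain U V where "U \<subseteq> W" "nbhd_of_zero_section U" "nbhd_of_zero_section V"
    "diffeo_between (\<lambda>(x, h). ((\<lambda>(x, h). legendre_minus (Hd h) (\<phi>d h) x) (x, h), h)) U V"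
    using fibre_diffeo[OF assms(1,2)] assms(3) by auto
  then have "inversion_domains W Hd \<phi>d U V"
    by (simp add: inversion_domains_def legendre_minus_family_def)
  then show ?thesis by blast
qed

lemma inversion_left:
  assumes "inversion_domains W Hd \<phi>d U V" "(x, h) \<in> U"
  shows "inv_into U (legendre_minus_family Hd \<phi>d) (legendre_minus (Hd h) (\<phi>d h) x, h) = (x, h)"
proof -
  have "bij_betw (legendre_minus_family Hd \<phi>d) U V"
    using assms(1) by (simp add: inversion_domains_def diffeo_between_def)
  from bij_betw_inv_into_left[OF this assms(2)] show ?thesis
    by (simp add: legendre_minus_family_def)
qed

lemma inversion_right:
  assumes "inversion_domains W Hd \<phi>d U V" "(y, h) \<in> V"
  obtains x where "inv_into U (legendre_minus_family Hd \<phi>d) (y, h) = (x, h)" "(x, h) \<in> U"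
    "legendre_minus (Hd h) (\<phi>d h) x = y"
proof -
  have bij: "bij_betw (legendre_minus_family Hd \<phi>d) U V"
    using assms(1) by (simp add: inversion_domains_def diffeo_between_def)
  obtain x h' where xh: "inv_into U (legendre_minus_family Hd \<phi>d) (y, h) = (x, h')"
    by (rule prod.exhaust)
  have "legendre_minus_family Hd \<phi>d (x, h') = (y, h)"
    using bij_betw_inv_into_right[OF bij assms(2)] by (simp only: xh)
  then have "legendre_minus (Hd h) (\<phi>d h) x = y" and h': "h' = h"
    by (auto simp: legendre_minus_family_def)
  moreover have "(x, h') \<in> U"
    using bij_betwE[OF bij_betw_inv_into[OF bij]] assms(2) xh by metis
  ultimately show ?thesis
    using xh that by (simp only: h')
qed

text \<open>Write \<open>\<Phi>\<close> for the first flow and let \<open>b\<close> be the point that the second minus transform maps to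
  \<open>y\<close>. The first minus transform maps it to \<open>y' = y + O(h\<^sup>k)\<close>, and the first plus transform to
  \<open>\<Phi> y'\<close>; hence the two flows at \<open>y\<close> differ by \<open>\<Phi> y - \<Phi> y'\<close> up to \<open>O(h\<^sup>k)\<close>.\<close>

lemma discrete_flow_order:
  assumes inv1: "inversion_domains W1 H1 \<phi>1 U1 V1" and inv2: "inversion_domains W2 H2 \<phi>2 U2 V2"
    and plus1: "smooth_on W1 (\<lambda>(x, h). legendre_plus (H1 h) (\<phi>1 h) x)"
    and zero2: "\<And>x. legendre_minus (H2 0) (\<phi>2 0) x = x"
    and k: "k > 0" and U: "nbhd_of_zero_section U"
    and minus: "continuous_on U \<Delta>m" "\<And>x h. (x, h) \<in> U \<Longrightarrow>
      legendre_minus (H2 h) (\<phi>2 h) x - legendre_minus (H1 h) (\<phi>1 h) x = h ^ k *\<^sub>R \<Delta>m (x, h)"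
    and plus: "continuous_on U \<Delta>p" "\<And>x h. (x, h) \<in> U \<Longrightarrow>
      legendre_plus (H2 h) (\<phi>2 h) x - legendre_plus (H1 h) (\<phi>1 h) x = h ^ k *\<^sub>R \<Delta>p (x, h)"
  shows "equal_up_to k V2 (discrete_flow H2 \<phi>2 U2) V1 (discrete_flow H1 \<phi>1 U1)"
proof -
  have nbhds: "nbhd_of_zero_section U1" "nbhd_of_zero_section V1" "nbhd_of_zero_section U2"
    "nbhd_of_zero_section V2"
    using inv1 inv2 by (auto simp: inversion_domains_def)
  then have opens: "open U1" "open V1" "open U2" "open V2" "open U"
    and zeros: "(x, 0) \<in> U1" "(x, 0) \<in> V1" "(x, 0) \<in> U2" "(x, 0) \<in> V2" "(x, 0) \<in> U" for x
    using U by (auto simp: nbhd_of_zero_section_def)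
  define g1 g2 where "g1 = inv_into U1 (legendre_minus_family H1 \<phi>1)"
    and "g2 = inv_into U2 (legendre_minus_family H2 \<phi>2)"
  have g1: "smooth_on V1 g1" "g1 ` V1 \<subseteq> U1" and g2: "smooth_on V2 g2"
    using inv1 inv2 bij_betwE[OF bij_betw_inv_into]
    unfolding inversion_domains_def diffeo_between_def g1_def g2_def by blast+
  have g2_cont: "continuous_on V2 g2"
    by (rule smooth_on_continuous[OF g2])
  have g2_zero: "g2 (x, 0) = (x, 0)" for x
    using inversion_left[OF inv2 zeros(3), of x] by (simp add: g2_def zero2)
  define \<Phi> where "\<Phi> = (\<lambda>(y, h). discrete_flow H1 \<phi>1 U1 h y)"
  have "smooth_on U1 (\<lambda>(x, h). legendre_plus (H1 h) (\<phi>1 h) x)"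
    using inv1 by (intro smooth_on_subset[OF plus1]) (simp add: inversion_domains_def)
  from smooth_on_compose[OF this opens(1,2) g1]
  have \<Phi>: "smooth_on V1 \<Phi>"
  proof (rule smooth_on_cong[OF _ opens(2)])
    fix z assume "z \<in> V1"
    moreover obtain y h where z: "z = (y, h)" by (rule prod.exhaust)
    ultimately obtain x where "g1 (y, h) = (x, h)"
      using inversion_right[OF inv1] unfolding g1_def by metis
    then show "(\<lambda>(x, h). legendre_plus (H1 h) (\<phi>1 h) x) (g1 z) = \<Phi> z"
      by (simp add: \<Phi>_def z discrete_flow_def g1_def)
  qed
  define \<Delta> where "\<Delta> z = - \<Delta>m (g2 z)" for z
  define N0 where "N0 = V1 \<inter> (V2 \<inter> g2 -` (U \<inter> U1))"
  have N0: "open N0"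
    unfolding N0_def by (intro open_Int continuous_open_preimage g2_cont opens)
  have N0_zero: "(x, 0) \<in> N0" for x
    by (simp add: N0_def g2_zero zeros)
  have \<Delta>: "continuous_on N0 \<Delta>" and \<Delta>p': "continuous_on N0 (\<lambda>z. \<Delta>p (g2 z))"
    unfolding \<Delta>_def
    by (intro continuous_intros continuous_on_compose2[OF minus(1)] continuous_on_compose2[OF plus(1)]
        continuous_on_subset[OF g2_cont]; auto simp: N0_def)+
  let ?m = "\<lambda>z. fst z + snd z ^ k *\<^sub>R \<Delta> z"
  \<comment> \<open>A single box with convex base \<open>A\<close> has to contain both
    \<open>y\<close> and the displaced point \<open>?m\<close>; then the whole segment between them
    stays in \<open>V1\<close>.\<close>
  define N where "N = (\<Union>(A, B)\<in>{(A, B). open A \<and> convex A \<and> open B \<and> A \<times> B \<subseteq> V1}.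
    N0 \<inter> (\<lambda>z. (fst z, snd z, ?m z)) -` (A \<times> B \<times> A))"
  have N_sub: "N \<subseteq> N0" unfolding N_def by blast
  have "open N"
    unfolding N_def
    by (intro open_UN ballI) (auto intro!: continuous_open_preimage continuous_intros \<Delta> N0 open_Times)
  moreover have "(x, 0) \<in> N" for x
  proof -
    obtain A B where AB: "open A" "open B" "x \<in> A" "0 \<in> B" "A \<times> B \<subseteq> V1"
      by (rule open_prod_elim[OF opens(2) zeros(2)[of x]]) auto
    then obtain e where e: "e > 0" "ball x e \<subseteq> A"
      using open_contains_ball by blast
    then have "ball x e \<times> B \<subseteq> V1" using AB by blast
    \<comment> \<open>Because \<open>k > 0\<close>, the displacement vanishes at
      \<open>h = 0\<close>, so a ball around \<open>x\<close> contains both points.\<close>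
    then show ?thesis
      unfolding N_def using AB e N0_zero[of x] k by (intro UN_I[of "(ball x e, B)"]) (auto simp: power_0_left)
  qed
  ultimately have N: "nbhd_of_zero_section N"
    by (auto simp: nbhd_of_zero_section_def)
  have seg: "(y + (s * h ^ k) *\<^sub>R \<Delta> (y, h), h) \<in> V1" if yh: "(y, h) \<in> N" and s: "s \<in> {0..1}" for y h s
  proof -
    obtain A B where AB: "convex A" "A \<times> B \<subseteq> V1" "y \<in> A" "h \<in> B" "y + h ^ k *\<^sub>R \<Delta> (y, h) \<in> A"
      using yh unfolding N_def by auto
    have "(1 - s) *\<^sub>R y + s *\<^sub>R (y + h ^ k *\<^sub>R \<Delta> (y, h)) \<in> A"
      using AB s by (intro convexD_alt) auto
    then have "y + (s * h ^ k) *\<^sub>R \<Delta> (y, h) \<in> A"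
      by (simp add: algebra_simps)
    then show ?thesis using AB by blast
  qed
  obtain \<delta> where \<delta>: "continuous_on N \<delta>"
    "\<And>y h. (y, h) \<in> N \<Longrightarrow> \<Phi> (y + h ^ k *\<^sub>R \<Delta> (y, h), h) - \<Phi> (y, h) = h ^ k *\<^sub>R \<delta> (y, h)"
    using fibre_increment[OF \<Phi> opens(2) continuous_on_subset[OF \<Delta> N_sub] seg] by blast
  show ?thesis
    unfolding equal_up_to_def
  proof (intro exI conjI)
    show "continuous_on N (\<lambda>z. - \<delta> z - \<Delta>p (g2 z))"
      by (intro continuous_intros \<delta> continuous_on_subset[OF \<Delta>p' N_sub])
    show "N \<subseteq> V2 \<inter> V1" using N_sub by (auto simp: N0_def)
    show "\<forall>(y, h)\<in>N. discrete_flow H1 \<phi>1 U1 h y - discrete_flow H2 \<phi>2 U2 h y =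
        h ^ k *\<^sub>R (- \<delta> (y, h) - \<Delta>p (g2 (y, h)))"
    proof clarify
      fix y h assume yh: "(y, h) \<in> N"
      then have V: "(y, h) \<in> V2" and gU: "g2 (y, h) \<in> U" "g2 (y, h) \<in> U1"
        using N_sub by (auto simp: N0_def)
      obtain b where b: "g2 (y, h) = (b, h)" "legendre_minus (H2 h) (\<phi>2 h) b = y"
        using inversion_right[OF inv2 V] unfolding g2_def by metis
      have bU: "(b, h) \<in> U" "(b, h) \<in> U1" using gU by (simp_all only: b)
      have y': "legendre_minus (H1 h) (\<phi>1 h) b = y + h ^ k *\<^sub>R \<Delta> (y, h)"
      proof -
        have "\<Delta> (y, h) = - \<Delta>m (b, h)" by (simp add: \<Delta>_def b(1))
        then show ?thesis using minus(2)[OF bU(1)] by (simp add: b(2) algebra_simps)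
      qed
      have "\<Phi> (y + h ^ k *\<^sub>R \<Delta> (y, h), h) = legendre_plus (H1 h) (\<phi>1 h) b"
        using inversion_left[OF inv1 bU(2)] by (simp add: \<Phi>_def discrete_flow_def y')
      moreover have "discrete_flow H2 \<phi>2 U2 h y = legendre_plus (H2 h) (\<phi>2 h) b"
        using b(1) by (simp add: discrete_flow_def g2_def)
      moreover have "discrete_flow H1 \<phi>1 U1 h y = \<Phi> (y, h)"
        by (simp add: \<Phi>_def)
      ultimately show "discrete_flow H1 \<phi>1 U1 h y - discrete_flow H2 \<phi>2 U2 h y =
          h ^ k *\<^sub>R (- \<delta> (y, h) - \<Delta>p (g2 (y, h)))"
        using \<delta>(2)[OF yh] plus(2)[OF bU(1)] by (simp add: b(1) algebra_simps)
    qed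
  qed (rule N)
qed

section \<open>From the order of the generating data to the order of the Legendre transforms\<close>

lemma differential_order:
  assumes H1: "smooth_on W1 (\<lambda>(x, h). H1 h x)" and H2: "smooth_on W2 (\<lambda>(x, h). H2 h x)"
    and U: "nbhd_of_zero_section U" "U \<subseteq> W1 \<inter> W2"
    and star: "\<And>x h s. (x, h) \<in> U \<Longrightarrow> s \<in> {0..1} \<Longrightarrow> (x, s * h) \<in> U"
    and \<delta>: "continuous_on U \<delta>" "\<And>x h. (x, h) \<in> U \<Longrightarrow> H2 h x - H1 h x = h ^ k *\<^sub>R (\<delta> (x, h) :: real)"
  shows "smooth_on U \<delta>"
    and "(x, h) \<in> U \<Longrightarrow> differential (H2 h) x - differential (H1 h) x = h ^ k *\<^sub>R fibre_deriv \<delta> (x, h)"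
proof -
  have oU: "open U" using U by (simp add: nbhd_of_zero_section_def)
  have "smooth_on U (\<lambda>(x, h). H1 h x)" "smooth_on U (\<lambda>(x, h). H2 h x)"
    using U(2) by (auto intro: smooth_on_subset[OF H1] smooth_on_subset[OF H2])
  then have diff: "smooth_on U (\<lambda>z. (\<lambda>(x, h). H2 h x) z - (\<lambda>(x, h). H1 h x) z)"
    by (intro smooth_on_diff oU)
  show *: "smooth_on U \<delta>"
  proof (rule smooth_quotient[OF oU _ \<delta>(1) diff])
    show "(x, s * h) \<in> U" if "(x, h) \<in> U" "s \<in> {0..1}" for x h s
      using star that .
    show "(\<lambda>(x, h). H2 h x) (x, h) - (\<lambda>(x, h). H1 h x) (x, h) = h ^ k *\<^sub>R \<delta> (x, h)" if "(x, h) \<in> U" for x h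
      using \<delta>(2)[OF that] by simp
  qed
  assume xh: "(x, h) \<in> U"
  have oUh: "open ((\<lambda>x. (x, h)) -` U)"
    by (intro open_vimage oU continuous_intros)
  have D1: "(H1 h has_derivative blinfun_apply (differential (H1 h) x)) (at x)"
    and D2: "(H2 h has_derivative blinfun_apply (differential (H2 h) x)) (at x)"
    using has_derivative_fibre[OF H1, of x h] has_derivative_fibre[OF H2, of x h] xh U(2)
      differential_fibre[OF H1, of x h] differential_fibre[OF H2, of x h] by auto
  have "((\<lambda>x. h ^ k *\<^sub>R \<delta> (x, h)) has_derivative
      (\<lambda>v. h ^ k *\<^sub>R blinfun_apply (fibre_deriv \<delta> (x, h)) v)) (at x)"
    by (intro has_derivative_scaleR_right has_derivative_fibre[OF * xh])
  then have "((\<lambda>x. H2 h x - H1 h x) has_derivative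
      (\<lambda>v. h ^ k *\<^sub>R blinfun_apply (fibre_deriv \<delta> (x, h)) v)) (at x)"
    by (rule has_derivative_transform_within_open[OF _ oUh]) (use xh \<delta>(2) in auto)
  note eq = has_derivative_unique[OF has_derivative_diff[OF D2 D1] this]
  show "differential (H2 h) x - differential (H1 h) x = h ^ k *\<^sub>R fibre_deriv \<delta> (x, h)"
    by (rule blinfun_eqI) (use fun_cong[OF eq] in \<open>simp only: blinfun.diff_left blinfun.scaleR_left\<close>)
qed

lemma legendre_order:
  assumes H1: "smooth_on W1 (\<lambda>(x, h). H1 h x)" and H2: "smooth_on W2 (\<lambda>(x, h). H2 h x)"
    and H_order: "equal_up_to k W1 H1 W2 H2" and \<phi>_order: "equal_up_to k W1 \<phi>1 W2 \<phi>2"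
  obtains U \<Delta>m \<Delta>p where "nbhd_of_zero_section U" "continuous_on U \<Delta>m" "continuous_on U \<Delta>p"
    "\<And>x h. (x, h) \<in> U \<Longrightarrow>
      legendre_minus (H2 h) (\<phi>2 h) x - legendre_minus (H1 h) (\<phi>1 h) x = h ^ k *\<^sub>R \<Delta>m (x, h)"
    "\<And>x h. (x, h) \<in> U \<Longrightarrow>
      legendre_plus (H2 h) (\<phi>2 h) x - legendre_plus (H1 h) (\<phi>1 h) x = h ^ k *\<^sub>R \<Delta>p (x, h)"
proof -
  obtain UH \<delta>H where UH: "nbhd_of_zero_section UH" "UH \<subseteq> W1 \<inter> W2" "continuous_on UH \<delta>H"
    "\<And>x h. (x, h) \<in> UH \<Longrightarrow> H2 h x - H1 h x = h ^ k *\<^sub>R \<delta>H (x, h)"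
    using H_order unfolding equal_up_to_def by blast
  obtain U\<phi> \<delta>\<phi> where U\<phi>: "nbhd_of_zero_section U\<phi>" "continuous_on U\<phi> \<delta>\<phi>"
    "\<And>x h. (x, h) \<in> U\<phi> \<Longrightarrow> \<phi>2 h x - \<phi>1 h x = h ^ k *\<^sub>R \<delta>\<phi> (x, h)"
    using \<phi>_order unfolding equal_up_to_def by blast
  obtain U where U: "nbhd_of_zero_section U" "U \<subseteq> UH \<inter> U\<phi>"
    "\<And>x h s. (x, h) \<in> U \<Longrightarrow> s \<in> {0..1} \<Longrightarrow> (x, s * h) \<in> U"
    using nbhd_of_zero_section_star[OF nbhd_of_zero_section_Int[OF UH(1) U\<phi>(1)]] by blast
  have oU: "open U" using U by (simp add: nbhd_of_zero_section_def)
  have H_U: "H2 h x - H1 h x = h ^ k *\<^sub>R \<delta>H (x, h)" if "(x, h) \<in> U" for x h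
    using that U(2) UH(4) by blast
  have "U \<subseteq> W1 \<inter> W2" using U(2) UH(2) by blast
  note D = differential_order[OF H1 H2 U(1) this U(3) continuous_on_subset[OF UH(3)] H_U]
  have D_cont: "continuous_on U (fibre_deriv \<delta>H)"
    using D(1) U(2) by (intro smooth_on_continuous smooth_on_fibre_deriv oU) auto
  have \<phi>_cont: "continuous_on U \<delta>\<phi>" using U(2) by (intro continuous_on_subset[OF U\<phi>(2)]) auto
  show ?thesis
  proof (rule that[OF U(1)])
    \<comment> \<open>Minus transforms keep the position and plus transforms keep the momentum,
      hence the zero components.\<close>
    let ?\<Delta>m = "\<lambda>z. (0, qcomp (fibre_deriv \<delta>H z - \<delta>\<phi> z))" and ?\<Delta>p = "\<lambda>z. (pcomp (fibre_deriv \<delta>H z - \<delta>\<phi> z), 0)"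
    show "continuous_on U ?\<Delta>m" "continuous_on U ?\<Delta>p"
      by (intro continuous_intros bounded_linear.continuous_on[OF bounded_linear_qcomp]
          bounded_linear.continuous_on[OF bounded_linear_pcomp] D_cont \<phi>_cont)+
    fix x h assume xh: "(x, h) \<in> U"
    let ?l = "fibre_deriv \<delta>H (x, h) - \<delta>\<phi> (x, h)"
    have *: "differential (H2 h) x - \<phi>2 h x - (differential (H1 h) x - \<phi>1 h x) = h ^ k *\<^sub>R ?l"
    proof -
      have "differential (H2 h) x - differential (H1 h) x = h ^ k *\<^sub>R fibre_deriv \<delta>H (x, h)"
        using U(2) xh by (intro D(2)) auto
      moreover have "\<phi>2 h x - \<phi>1 h x = h ^ k *\<^sub>R \<delta>\<phi> (x, h)"
        using U(2) xh U\<phi>(3) by blast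
      ultimately show ?thesis by (simp add: algebra_simps)
    qed
    note q = bounded_linear.linear[OF bounded_linear_qcomp] and p = bounded_linear.linear[OF bounded_linear_pcomp]
    show "legendre_minus (H2 h) (\<phi>2 h) x - legendre_minus (H1 h) (\<phi>1 h) x = h ^ k *\<^sub>R ?\<Delta>m (x, h)"
      using arg_cong[OF *, of qcomp]
      by (simp add: legendre_minus_def D1_def linear_diff[OF q] linear_cmul[OF q])
    show "legendre_plus (H2 h) (\<phi>2 h) x - legendre_plus (H1 h) (\<phi>1 h) x = h ^ k *\<^sub>R ?\<Delta>p (x, h)"
      using arg_cong[OF *, of pcomp]
      by (simp add: legendre_plus_def D2_def linear_diff[OF p] linear_cmul[OF p])
  qed
qed

section \<open>The exact discrete flow, the time-h flow and the conclusion\<close>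

lemma (in smooth_boundary_flow) legendre_exact_zero:
  "legendre_minus (exact_H H F 0) (exact_\<phi> \<phi> F 0) x = x"
  using legendre_exact(1)[OF zero_W] Z_F[OF zero_W, of 0] by (simp add: Z_zero)

text \<open>The inverse minus transform finds the boundary data whose trajectory starts at
  \<open>y\<close>. That trajectory witnesses membership in the flow domain, and by uniqueness its
  end point, which the plus transform reads off, is the value of \<open>flow\<close>.\<close>

lemma (in smooth_boundary_flow) flow_eq_exact_discrete_flow:
  assumes inv: "inversion_domains W (exact_H H F) (exact_\<phi> \<phi> F) U V" and yh: "(y, h) \<in> V"
  shows "(y, h) \<in> flow_domain H \<phi>"
    and "flow H \<phi> h y = discrete_flow (exact_H H F) (exact_\<phi> \<phi> F) U h y"
proof -
  obtain x where x: "inv_into U (legendre_minus_family (exact_H H F) (exact_\<phi> \<phi> F)) (y, h) = (x, h)"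
    "(x, h) \<in> U" "legendre_minus (exact_H H F h) (exact_\<phi> \<phi> F h) x = y"
    by (rule inversion_right[OF inv yh])
  then have W: "(x, h) \<in> W" using inv by (auto simp: inversion_domains_def)
  then have y: "F h 0 x = y" using x(3) legendre_exact(1) by simp
  with traj[OF W] show "(y, h) \<in> flow_domain H \<phi>"
    by (auto simp: flow_domain_def)
  show "flow H \<phi> h y = discrete_flow (exact_H H F) (exact_\<phi> \<phi> F) U h y"
    using flow_eq[OF sys traj[OF W]] x(1) by (simp add: y discrete_flow_def legendre_exact(2)[OF W])
qed

text \<open>The existence of inversion domains is asserted separately, so that the claim about all
  choices of them is not vacuous.\<close>

theorem theorem6p14:
  fixes H :: "'q::euclidean_space phase \<Rightarrow> real"
    and \<phi> :: "'q phase \<Rightarrow> 'q covector"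
    and W Wd :: "('q phase \<times> real) set"
    and F :: "real \<Rightarrow> real \<Rightarrow> 'q phase \<Rightarrow> 'q phase"
    and Hd :: "real \<Rightarrow> 'q phase \<Rightarrow> real"
    and \<phi>d :: "real \<Rightarrow> 'q phase \<Rightarrow> 'q covector"
    and r :: nat
  assumes "forced_hamiltonian_system H \<phi>"
    and "boundary_value_flow H \<phi> W F"
    and "discretization H \<phi> Wd Hd \<phi>d"
    and "contact_order r H \<phi> W F Wd Hd \<phi>d"
  shows "(\<exists>U V. inversion_domains W (exact_H H F) (exact_\<phi> \<phi> F) U V) \<and>
    (\<exists>U V. inversion_domains Wd Hd \<phi>d U V) \<and>
    (\<forall>UE VE Ud Vd.
       inversion_domains W (exact_H H F) (exact_\<phi> \<phi> F) UE VE \<and>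
       inversion_domains Wd Hd \<phi>d Ud Vd \<longrightarrow>
       (\<exists>N. nbhd_of_zero_section N \<and> N \<subseteq> flow_domain H \<phi> \<inter> VE \<and>
          (\<forall>(x, h)\<in>N. flow H \<phi> h x = discrete_flow (exact_H H F) (exact_\<phi> \<phi> F) UE h x)) \<and>
       equal_up_to (r + 1) Vd (discrete_flow Hd \<phi>d Ud)
         VE (discrete_flow (exact_H H F) (exact_\<phi> \<phi> F) UE))"
proof -
  obtain \<Omega> G where "open \<Omega>" "smooth_on \<Omega> G" and
    "\<forall>t h x. (x, h) \<in> W \<and> t \<in> closed_segment 0 h \<longrightarrow> (t, h, x) \<in> \<Omega> \<and> G (t, h, x) = F h t x"
    using assms(2) unfolding boundary_value_flow_def by blast
  then interpret smooth_boundary_flow H \<phi> W F \<Omega> G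
    using assms(1,2) by unfold_locales (auto simp: boundary_value_flow_def)
  have family: "smooth_family Wd Hd \<phi>d"
    using assms(3) by (simp add: discretization_def)
  then have Wd: "nbhd_of_zero_section Wd" and Hd: "smooth_on Wd (\<lambda>(x, h). Hd h x)"
    by (simp_all add: smooth_family_def)
  obtain U \<Delta>m \<Delta>p where order: "nbhd_of_zero_section U" "continuous_on U \<Delta>m" "continuous_on U \<Delta>p"
    "\<And>x h. (x, h) \<in> U \<Longrightarrow> legendre_minus (Hd h) (\<phi>d h) x -
      legendre_minus (exact_H H F h) (exact_\<phi> \<phi> F h) x = h ^ (r + 1) *\<^sub>R \<Delta>m (x, h)"
    "\<And>x h. (x, h) \<in> U \<Longrightarrow> legendre_plus (Hd h) (\<phi>d h) x -
      legendre_plus (exact_H H F h) (exact_\<phi> \<phi> F h) x = h ^ (r + 1) *\<^sub>R \<Delta>p (x, h)"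
    using legendre_order[OF smooth_exact_H Hd] assms(4) unfolding contact_order_def by blast
  have "\<exists>N. nbhd_of_zero_section N \<and> N \<subseteq> flow_domain H \<phi> \<inter> VE \<and>
      (\<forall>(x, h)\<in>N. flow H \<phi> h x = discrete_flow (exact_H H F) (exact_\<phi> \<phi> F) UE h x)"
    if "inversion_domains W (exact_H H F) (exact_\<phi> \<phi> F) UE VE" for UE VE
    using that flow_eq_exact_discrete_flow[OF that]
    by (intro exI[of _ VE]) (auto simp: inversion_domains_def)
  moreover have "equal_up_to (r + 1) Vd (discrete_flow Hd \<phi>d Ud) VE (discrete_flow (exact_H H F) (exact_\<phi> \<phi> F) UE)"
    if "inversion_domains W (exact_H H F) (exact_\<phi> \<phi> F) UE VE" "inversion_domains Wd Hd \<phi>d Ud Vd" for UE VE Ud Vd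
    \<comment> \<open>The exact system takes the first role, so \<open>\<Phi>\<close> is the exact
      flow; the discretization contributes that its minus transform is the identity at
      \<open>h = 0\<close>.\<close>
    by (rule discrete_flow_order[OF that smooth_legendre_exact(2) discretization_legendre_zero[OF assms(3)] _
          order(1,2,4,3,5)]) simp_all
  ultimately show ?thesis
    using ex_inversion_domains[OF W smooth_legendre_exact(1) legendre_exact_zero]
      ex_inversion_domains[OF Wd smooth_legendre_minus[OF family] discretization_legendre_zero[OF assms(3)]]
    by blast
qed

end
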